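(* For real $z$ with $0<z<\pi$, \[ \sum_{k=0}^{\infty }\frac{z^{k}}{k!}\zeta'(-k)- \frac{\gamma}{z}+\sum_{n\geq 1}^{Borel}\frac{(-1)^{n+1}n!}{z^{n+1}}\zeta (n+1) =\frac{1}{e^{z}-1}\mathcal{L}\left(\frac{1}{x+1}\right)(z)-\sum_{k\ge 0} \frac{z^{k}}{(k+1)!}\frac{1}{k+1}-\sum_{k\geq 0}\frac{z^{k}}{k!}\sum_{m=1}^{k}\frac{B_{m}}{m!}\frac{H_{k-m+1}}{(k-m+1)!}-\sum_{k\geq 1}\frac{z^{k}}{k!}H_{k}\left(\frac{1-B_{k+1}}{k+1}\right). \]
   Context: For $f$ analytic on $\{\operatorname{Re}x>0\}$ (or continuous on $[0,\infty)$) of subexponential growth, the Laplace transform is $\mathcal L(f(x))(z)=\int_0^\infty e^{-xz}f(x)\,dx$ for $z>0$. Borel sum: a series $\sum_{n\ge0}c_n/z^{n+1}$ is Borel summable for $z>0$ if $\sum_{n\ge0}c_nx^n/n!$ has positive radius of convergence, its sum $g(x)$ continues analytically along $\mathbb R_+$, and $\int_0^\infty e^{-xz}g(x)\,dx$ converges for $z>0$; then $\sum^{Borel}_{n\ge0}c_n/z^{n+1}:=\int_0^\infty e^{-xz}g(x)\,dx$ (for a series starting at $n=1$, take $c_0=0$). $\gamma$ is Euler's constant, $\zeta$ the Riemann zeta function, $H_k=\sum_{j=1}^k1/j$ ($H_0=0$), and the Bernoulli numbers are defined by $\frac{t}{e^t-1}=\sum_{n\ge0}B_nt^n/n!$. An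 empty sum ($k=0$) is $0$.
   Formalization: In the double sum over k and m with B_m and H_{k-m+1}, the outer factor z^k/k! is replaced by z^k; as printed the identity is false, since the two versions differ by about (7/48)z^2 in absolute value for small z>0. *)

theory Defs
  imports "HOL-Complex_Analysis.Complex_Analysis"
begin

(* The Riemann zeta function is the analytic continuation of its Dirichlet series to the
   complex plane without 1. The value at the pole 1 is left unspecified. *)

definition is_zeta_continuation :: "(complex \<Rightarrow> complex) \<Rightarrow> bool" where
  "is_zeta_continuation f \<longleftrightarrow>
     f holomorphic_on (- {1}) \<and>
     (\<forall>s. Re s > 1 \<longrightarrow> (\<lambda>n. 1 / of_nat (Suc n) powr s) sums f s)"

definition zeta :: "complex \<Rightarrow> complex" where
  "zeta = (SOME f. is_zeta_continuation f)"

lemma is_zeta_continuation_unique: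
  assumes f: "is_zeta_continuation f" and g: "is_zeta_continuation g" and s: "s \<noteq> 1"
  shows "f s = g s"
proof (rule analytic_continuation_open[where f = f and g = g and s = "{s. Re s > 1}" and s' = "- {1}"])
  show "open {s. Re s > 1}"
    by (rule open_halfspace_Re_gt)
  show "{s. Re s > 1} \<noteq> {}"
    by (auto intro: exI[of _ 2])
  show "connected (- {1::complex})"
    by (simp add: connected_punctured_universe)
  show "f z = g z" if "z \<in> {s. Re s > 1}" for z
    using f g that unfolding is_zeta_continuation_def by (auto intro: sums_unique2)
qed (use f g s in \<open>auto simp: is_zeta_continuation_def\<close>)

definition bernoulli :: "nat \<Rightarrow> real" where
  "bernoulli n = fact n * fps_nth (fps_X / (fps_exp 1 - 1)) n"

(* The quotient of formal power series is exact, both series having subdegree 1. *)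

lemma bernoulli_generating_function:
  "(fps_exp 1 - 1) * Abs_fps (\<lambda>n. bernoulli n / fact n) = fps_X"
proof -
  let ?E = "fps_exp 1 - 1 :: real fps"
  have "fps_nth ?E 1 \<noteq> 0"
    by simp
  then have E: "?E \<noteq> 0" "subdegree ?E \<le> 1"
    by (auto intro: subdegree_leI)
  then have "?E dvd fps_X"
    by (simp add: fps_dvd_iff)
  moreover have "Abs_fps (\<lambda>n. bernoulli n / fact n) = fps_X / ?E"
    by (simp add: fps_eq_iff bernoulli_def)
  ultimately show ?thesis
    by simp
qed

(* The gauge integral over the closed half-line: by Hake's theorem this is the improper
   integral, conditionally convergent integrals included. *)

definition laplace_converges :: "(real \<Rightarrow> 'a::banach) \<Rightarrow> real \<Rightarrow> bool" where
  "laplace_converges f z \<longleftrightarrow> (\<lambda>x. exp (- (x * z)) *\<^sub>R f x) integrable_on {0..}"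

definition laplace :: "(real \<Rightarrow> 'a::banach) \<Rightarrow> real \<Rightarrow> 'a" where
  "laplace f z = integral {0..} (\<lambda>x. exp (- (x * z)) *\<^sub>R f x)"

(* The function g continues the Borel transform of the series with terms c n / z ^ (n + 1) to a
   neighbourhood of the half-line. Only its values on the half-line matter, and these are
   determined by c. *)

definition borel_continuation :: "(nat \<Rightarrow> complex) \<Rightarrow> (complex \<Rightarrow> complex) \<Rightarrow> bool" where
  "borel_continuation c g \<longleftrightarrow>
     conv_radius (\<lambda>n. c n / fact n) > 0 \<and>
     g analytic_on (complex_of_real ` {0..}) \<and>
     (\<forall>\<^sub>F w in nhds 0. (\<lambda>n. c n / fact n * w ^ n) sums g w)"

definition borel_summable :: "(nat \<Rightarrow> complex) \<Rightarrow> bool" where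
  "borel_summable c \<longleftrightarrow>
     (\<exists>g. borel_continuation c g \<and>
          (\<forall>z>0. laplace_converges (\<lambda>x. g (complex_of_real x)) z))"

definition borel_sum :: "(nat \<Rightarrow> complex) \<Rightarrow> real \<Rightarrow> complex" where
  "borel_sum c z =
     laplace (\<lambda>x. (SOME g. borel_continuation c g) (complex_of_real x)) z"

lemma borel_continuation_unique:
  assumes f: "borel_continuation c f" and g: "borel_continuation c g" and x: "x \<ge> 0"
  shows "f (complex_of_real x) = g (complex_of_real x)"
proof -
  define L where "L = complex_of_real ` {0..}"
  have "(\<lambda>w. f w - g w) analytic_on L"
    using f g by (auto simp: borel_continuation_def L_def intro: analytic_on_diff)
  then obtain S where S: "open S" "L \<subseteq> S" "(\<lambda>w. f w - g w) holomorphic_on S"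
    by (auto simp: analytic_on_holomorphic)
  define C where "C = connected_component_set S 0"
  have "connected L"
    unfolding L_def by (intro connected_continuous_image continuous_intros) auto
  moreover have L: "0 \<in> L" "complex_of_real x \<in> L"
    using x by (auto simp: L_def image_iff intro: bexI[of _ 0])
  ultimately have LC: "L \<subseteq> C"
    unfolding C_def using S by (intro connected_component_maximal)
  have C: "open C" "connected C" "C \<subseteq> S"
    unfolding C_def using S by (auto intro: open_connected_component simp: connected_component_in)
  have "\<forall>\<^sub>F w in nhds 0. f w - g w = 0"
  proof -
    have "\<forall>\<^sub>F w in nhds 0. (\<lambda>n. c n / fact n * w ^ n) sums f w"
      and "\<forall>\<^sub>F w in nhds 0. (\<lambda>n. c n / fact n * w ^ n) sums g w"
      using f g by (simp_all only: borel_continuation_def)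
    then show ?thesis
      by eventually_elim (metis sums_unique2 right_minus_eq)
  qed
  then obtain B where B: "open B" "0 \<in> B" "\<And>w. w \<in> B \<Longrightarrow> f w - g w = 0"
    by (auto simp: eventually_nhds)
  have "f (complex_of_real x) - g (complex_of_real x) = 0"
  proof (rule analytic_continuation_open[where f = "\<lambda>w. f w - g w" and s = "B \<inter> C" and s' = C and g = "\<lambda>_. 0"])
    show "(\<lambda>w. f w - g w) holomorphic_on C"
      using S C holomorphic_on_subset by blast
  qed (use B C L LC in auto)
  then show ?thesis
    by simp
qed

definition zeta_coeff :: "nat \<Rightarrow> complex" where
  "zeta_coeff n =
     (if n = 0 then 0 else (-1) ^ (n + 1) * fact n * zeta (of_nat (n + 1)))"

end

theory Submission
  imports Defs "HOL-Real_Asymp.Real_Asymp"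
begin

text \<open>
  Let \<open>\<phi> t = 1 / (exp t - 1) - 1 / t\<close>. Splitting the Mellin transform of \<open>1 / (exp t - 1)\<close> at \<open>pi\<close>
  and expanding \<open>\<phi>\<close>, whose Taylor coefficients are Bernoulli numbers, below \<open>pi\<close> continues
  \<open>Gamma s * zeta s\<close> and expresses \<open>zeta' (- k)\<close> through integrals of \<open>t ^ (- k - 1)\<close>. Multiplied by
  \<open>z ^ k / k!\<close> and summed over \<open>k\<close>, these become geometric series: for \<open>0 < z < pi\<close> the sum is the
  Stieltjes transform of \<open>\<phi>\<close> at \<open>z\<close> plus elementary terms and the series of \<open>H\<^sub>k * B\<^sub>k\<^sub>+\<^sub>1\<close>. The Borel
  transform of the Borel summed series is \<open>Digamma (x + 1) + \<gamma>\<close>, the integral of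
  \<open>(1 - exp (- x * t)) / (exp t - 1)\<close>, so by Tonelli its Laplace transform is minus the same Stieltjes
  transform plus elementary terms, and the two transforms cancel. On the right-hand side,
  \<open>exp (- z) * L (1 / (x + 1))\<close> is the exponential integral, whose entire part is
  \<open>exp (- z) * (\<Sum>j. H\<^sub>j * z ^ j / j!)\<close>; the other series combine
  to multiples of this one and the series of \<open>H\<^sub>k * B\<^sub>k\<^sub>+\<^sub>1\<close>.
\<close>

section \<open>Exchanging integrals with series and parameters\<close>

text \<open>The cut at \<open>pi\<close> serves two series at once. It lies inside the disc of
  radius \<open>2 * pi\<close>, whose boundary carries the next zeros of \<open>exp w - 1\<close>,
  so the Taylor series of \<phi> converges absolutely there; and it lies above \<open>z\<close>, so
  the geometric series in \<open>- z / t\<close> converges on the tail. The factor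
  \<open>(-1) ^ k\<close> in \<open>zeta' (- k)\<close> makes the kernel \<open>1 / (t + z)\<close>,
  which has no singularity on the half-line. The obstacle is the range below \<open>pi\<close>:
  there \<open>t\<close> may drop below \<open>z\<close> and the geometric series fails. The
  continued Mellin transform leaves a double series with denominators \<open>m - k\<close>, which is
  summed over \<open>k\<close> before \<open>m\<close>. Its diagonal is missing: the pole at
  \<open>s = - k\<close> has been cancelled by the zero of \<open>1 / Gamma\<close>, and this
  cancellation is the source of Euler's constant, \<open>ln pi\<close> and the harmonic numbers. The
  Stieltjes transform appears in three pieces: \<phi> over \<open>{0<..pi}\<close>,
  \<open>1 / (exp t - 1)\<close> over \<open>{pi..}\<close>, and \<open>ln (1 + z / pi) / z\<close>
  for the part \<open>1 / t\<close> of \<phi> beyond \<open>pi\<close>. The Laplace transform of the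
  digamma function yields the same three, and they cancel unmerged.\<close>

lemma has_integral_sums:
  fixes f :: "nat \<Rightarrow> 'n::euclidean_space \<Rightarrow> 'm::euclidean_space"
  assumes f: "\<And>k. (f k has_integral I k) S"
    and h: "\<And>k. (h k has_integral J k) S" "summable J"
    and le: "\<And>k x. x \<in> S \<Longrightarrow> norm (f k x) \<le> h k x"
    and hsum: "\<And>x. x \<in> S \<Longrightarrow> summable (\<lambda>k. h k x)"
    and g: "\<And>x. x \<in> S \<Longrightarrow> (\<lambda>k. f k x) sums g x"
  shows "summable (\<lambda>k. norm (I k))" and "(g has_integral (\<Sum>k. I k)) S"
proof -
  have nI: "norm (I k) \<le> J k" for k
    using integral_norm_bound_integral[OF has_integral_integrable[OF f[of k]] has_integral_integrable[OF h(1)[of k]] le]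
    by (simp add: integral_unique[OF f] integral_unique[OF h(1)])
  show sI: "summable (\<lambda>k. norm (I k))"
    by (rule summable_comparison_test'[OF h(2)]) (use nI in auto)
  define H where "H x = (\<Sum>k. h k x)" for x
  have h0: "h k x \<ge> 0" if "x \<in> S" for k x
    using le[OF that, of k] norm_ge_zero order_trans by blast
  \<comment> \<open>The sum \<open>H\<close> of the majorants is integrable by monotone convergence;
    it then dominates all partial sums of the \<open>f k\<close>. For non-negative terms
    \<open>h\<close> can be \<open>f\<close> itself.\<close>
  have "(H has_integral (\<Sum>k. J k)) S"
  proof (rule has_integral_monotone_convergence_increasing)
    show "((\<lambda>x. \<Sum>k<n. h k x) has_integral (\<Sum>k<n. J k)) S" for n
      by (intro has_integral_sum h) auto
    show "(\<lambda>n. \<Sum>k<n. h k x) \<longlonglongrightarrow> H x" if "x \<in> S" for x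
      unfolding H_def using hsum[OF that] by (rule summable_LIMSEQ)
    show "(\<lambda>n. \<Sum>k<n. J k) \<longlonglongrightarrow> (\<Sum>k. J k)"
      using h(2) by (rule summable_LIMSEQ)
  qed (use h0 in auto)
  then have Hi: "H integrable_on S"
    by blast
  show "(g has_integral (\<Sum>k. I k)) S"
  proof (rule has_integral_dominated_convergence[OF _ Hi])
    show "((\<lambda>x. \<Sum>k<n. f k x) has_integral (\<Sum>k<n. I k)) S" for n
      by (intro has_integral_sum f) auto
    show "\<forall>x\<in>S. norm (\<Sum>k<n. f k x) \<le> H x" for n
    proof
      fix x assume x: "x \<in> S"
      have "norm (\<Sum>k<n. f k x) \<le> (\<Sum>k<n. h k x)"
        by (rule order_trans[OF norm_sum sum_mono]) (use le x in auto)
      also have "\<dots> \<le> H x"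
        unfolding H_def using h0 x by (intro sum_le_suminf hsum) auto
      finally show "norm (\<Sum>k<n. f k x) \<le> H x" .
    qed
    show "\<forall>x\<in>S. (\<lambda>n. \<Sum>k<n. f k x) \<longlonglongrightarrow> g x"
      using g unfolding sums_def by blast
    show "(\<lambda>n. \<Sum>k<n. I k) \<longlonglongrightarrow> (\<Sum>k. I k)"
      by (rule summable_LIMSEQ[OF summable_norm_cancel[OF sI]])
  qed
qed

text \<open>Gauge integrals of non-negative functions are Lebesgue integrals, so Tonelli's theorem
  transfers through \<open>nn_integral\<close>. Integrability of \<open>g\<close> is part of the
  conclusion: it follows from the finite value \<open>I\<close> found in the other order.\<close>

lemma has_integral_Tonelli:
  fixes f :: "real \<Rightarrow> real \<Rightarrow> real"
  assumes f[measurable]: "(\<lambda>(x, t). f x t) \<in> borel_measurable (borel \<Otimes>\<^sub>M borel)"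
    and S[measurable]: "S \<in> sets borel" "T \<in> sets borel"
    and nonneg: "\<And>x t. x \<in> S \<Longrightarrow> t \<in> T \<Longrightarrow> f x t \<ge> 0"
    and g: "\<And>x. x \<in> S \<Longrightarrow> (f x has_integral g x) T"
    and h: "\<And>t. t \<in> T \<Longrightarrow> ((\<lambda>x. f x t) has_integral h t) S"
    and I: "(h has_integral I) T"
  shows "(g has_integral I) S"
proof -
  define k where "k x t = indicator S x * (indicator T t * f x t)" for x t
  have k[measurable]: "(\<lambda>(x, t). k x t) \<in> borel_measurable (borel \<Otimes>\<^sub>M borel)"
    unfolding k_def by measurable
  have g0: "g x \<ge> 0" if "x \<in> S" for x
    using has_integral_nonneg[OF g[OF that]] nonneg[OF that] by blast
  have h0: "h t \<ge> 0" if "t \<in> T" for t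
    using has_integral_nonneg[OF h[OF that]] nonneg[OF _ that] by blast
  have I0: "I \<ge> 0"
    using I h0 by (rule has_integral_nonneg)
  define g' where "g' x = indicator S x * g x" for x
  have g': "(\<integral>\<^sup>+t. ennreal (k x t) \<partial>lborel) = ennreal (g' x)" for x
  proof (cases "x \<in> S")
    case True
    then show ?thesis
      using nn_integral_has_integral_lebesgue[OF nonneg[OF True] g[OF True]]
      by (simp add: k_def g'_def)
  qed (simp add: k_def g'_def)
  have "(\<integral>\<^sup>+x. ennreal (g' x) \<partial>lborel) = (\<integral>\<^sup>+x. (\<integral>\<^sup>+t. ennreal (k x t) \<partial>lborel) \<partial>lborel)"
    by (simp add: g')
  also have "\<dots> = (\<integral>\<^sup>+t. (\<integral>\<^sup>+x. ennreal (k x t) \<partial>lborel) \<partial>lborel)"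
    by (rule lborel_pair.Fubini') simp
  also have "\<dots> = (\<integral>\<^sup>+t. ennreal (indicator T t * h t) \<partial>lborel)"
  proof (rule nn_integral_cong)
    fix t :: real
    show "(\<integral>\<^sup>+x. ennreal (k x t) \<partial>lborel) = ennreal (indicator T t * h t)"
    proof (cases "t \<in> T")
      case True
      then show ?thesis
        using nn_integral_has_integral_lebesgue[OF nonneg[OF _ True] h[OF True]]
        by (simp add: k_def)
    qed (simp add: k_def)
  qed
  also have "\<dots> = ennreal I"
    using nn_integral_has_integral_lebesgue[OF h0 I] by simp
  finally have *: "(\<integral>\<^sup>+x. ennreal (g' x) \<partial>lborel) = ennreal I" .
  have g'0: "g' x \<ge> 0" for x
    using g0 by (simp add: g'_def indicator_def)
  \<comment> \<open>Measurability of \<open>g'\<close> comes from its being an inner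
    \<open>nn_integral\<close> of a jointly measurable function.\<close>
  have "(\<lambda>x. enn2real (\<integral>\<^sup>+t. ennreal (k x t) \<partial>lborel)) \<in> borel_measurable borel"
    by measurable
  then have "g' \<in> borel_measurable borel"
    by (simp add: g' g'0)
  then have "(g' has_integral I) UNIV"
    using g'0 * I0 by (rule nn_integral_has_integral)
  moreover have "g' = (\<lambda>x. if x \<in> S then g x else 0)"
    by (simp add: g'_def fun_eq_iff)
  ultimately show ?thesis
    by (simp only: has_integral_restrict_UNIV)
qed

text \<open>The integral is the locally uniform limit of the integrals over \<open>{a..a + n}\<close>.\<close>

lemma holomorphic_on_integral_dominated:
  fixes f :: "complex \<Rightarrow> real \<Rightarrow> complex"
  assumes S: "open S"
    and f': "\<And>s t. s \<in> S \<Longrightarrow> t \<ge> a \<Longrightarrow> ((\<lambda>s. f s t) has_field_derivative f' s t) (at s)"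
    and cont: "continuous_on (S \<times> {a..}) (\<lambda>(s, t). f s t)"
    and cont': "continuous_on (S \<times> {a..}) (\<lambda>(s, t). f' s t)"
    and dom: "\<And>s. s \<in> S \<Longrightarrow> \<exists>d>0. \<exists>h. h integrable_on {a..} \<and>
                (\<forall>w\<in>cball s d. \<forall>t\<ge>a. w \<in> S \<and> norm (f w t) \<le> h t)"
  shows "(\<lambda>s. integral {a..} (f s)) holomorphic_on S"
    and "\<And>s. s \<in> S \<Longrightarrow> f s absolutely_integrable_on {a..}"
proof -
  have cs: "continuous_on T (f s)" if "s \<in> S" "T \<subseteq> {a..}" for s T
  proof -
    have "continuous_on T ((\<lambda>(s, t). f s t) \<circ> Pair s)"
      by (intro continuous_on_compose continuous_on_subset[OF cont] continuous_intros) (use that in auto)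
    then show ?thesis
      by (simp add: o_def)
  qed
  show int: "f s absolutely_integrable_on {a..}" if s: "s \<in> S" for s
  proof -
    obtain d h where "d > 0" and h: "h integrable_on {a..}"
      "\<forall>w\<in>cball s d. \<forall>t\<ge>a. w \<in> S \<and> norm (f w t) \<le> h t"
      using dom[OF s] by metis
    then have "norm (f s t) \<le> h t" if "t \<in> {a..}" for t
      using that by (metis atLeast_iff centre_in_cball less_imp_le)
    with h(1) show ?thesis
      by (intro measurable_bounded_by_integrable_imp_absolutely_integrable[of _ _ h]
            continuous_imp_measurable_on_sets_lebesgue cs[OF s]) auto
  qed
  have ii: "f s integrable_on {a..}" if "s \<in> S" for s
    using int[OF that] by (rule set_lebesgue_integral_eq_integral)
  show "(\<lambda>s. integral {a..} (f s)) holomorphic_on S"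
  proof (rule holomorphic_uniform_sequence[OF S])
    show "(\<lambda>s. integral {a..a + real n} (f s)) holomorphic_on S" for n
    proof (rule holomorphic_on_open[OF S, THEN iffD2], intro ballI)
      fix s assume "s \<in> S"
      with S obtain e where e: "e > 0" "ball s e \<subseteq> S"
        by (meson open_contains_ball)
      \<comment> \<open>Differentiation under the integral is applied on a convex set, hence the
        ball around \<open>s\<close>.\<close>
      have "(\<lambda>s. integral (cbox a (a + real n)) (f s)) holomorphic_on ball s e"
      proof (rule leibniz_rule_holomorphic)
        show "((\<lambda>s. f s t) has_field_derivative f' x t) (at x within ball s e)"
          if "x \<in> ball s e" "t \<in> cbox a (a + real n)" for x t
          using that e by (intro DERIV_subset[OF f']) auto
        show "f x integrable_on cbox a (a + real n)" if "x \<in> ball s e" for x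
          using that e by (intro integrable_continuous cs) auto
        show "continuous_on (ball s e \<times> cbox a (a + real n)) (\<lambda>(x, t). f' x t)"
          using e by (intro continuous_on_subset[OF cont']) auto
      qed auto
      then show "\<exists>f'. ((\<lambda>s. integral {a..a + real n} (f s)) has_field_derivative f') (at s)"
        using e by (auto simp: holomorphic_on_open)
    qed
    show "\<exists>d>0. cball s d \<subseteq> S \<and> uniform_limit (cball s d)
            (\<lambda>n s. integral {a..a + real n} (f s)) (\<lambda>s. integral {a..} (f s)) sequentially"
      if s: "s \<in> S" for s
    proof -
      obtain d h where d: "d > 0" and h: "h integrable_on {a..}"
        and le: "\<And>w t. w \<in> cball s d \<Longrightarrow> t \<ge> a \<Longrightarrow> norm (f w t) \<le> h t"
        and sub: "\<And>w. w \<in> cball s d \<Longrightarrow> w \<in> S"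
        using dom[OF s] by blast
      \<comment> \<open>\<open>T n\<close> bounds the missing tail for all \<open>w\<close> in the
        disc simultaneously; this is where the uniformity comes from.\<close>
      define T where "T n = integral {a..} (\<lambda>t. if t \<le> a + real n then 0 else h t)" for n
      have h0: "h t \<ge> 0" if "t \<ge> a" for t
        using order_trans[OF norm_ge_zero le[OF _ that, of s]] d by simp
      have hI: "(\<lambda>t. if t \<le> a + real n then 0 else h t) integrable_on {a..}" for n
      proof -
        have "h absolutely_integrable_on {a..}"
          using h h0 by (subst absolutely_integrable_on_iff_nonneg) auto
        then have "h absolutely_integrable_on ({a..} \<inter> {a + real n<..})"
          by (rule set_integrable_subset) auto
        then have "h integrable_on ({a..} \<inter> {a + real n<..})"
          by (rule set_lebesgue_integral_eq_integral)
        then have "(\<lambda>t. if t \<in> {a + real n<..} then h t else 0) integrable_on {a..}"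
          by (simp only: integrable_restrict_Int Int_commute)
        then show ?thesis
          by (rule integrable_eq) auto
      qed
      have "(\<lambda>n. integral {a..} (\<lambda>t. if t \<le> a + real n then 0 else h t)) \<longlonglongrightarrow> integral {a..} (\<lambda>t::real. 0::real)"
      proof (rule dominated_convergence(2)[OF hI h])
        show "(\<lambda>n. if t \<le> a + real n then 0 else h t) \<longlonglongrightarrow> 0" for t
        proof -
          have "\<forall>\<^sub>F n in sequentially. (if t \<le> a + real n then 0 else h t) = 0"
          proof (rule eventually_sequentiallyI)
            fix n assume "nat \<lceil>t - a\<rceil> \<le> n"
            then have "t \<le> a + real n"
              by linarith
            then show "(if t \<le> a + real n then 0 else h t) = 0"
              by simp
          qed
          then show "(\<lambda>n. if t \<le> a + real n then 0 else h t) \<longlonglongrightarrow> 0"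
            by (rule tendsto_eventually)
        qed
        show "norm (if t \<le> a + real n then 0 else h t) \<le> h t" if "t \<in> {a..}" for n t
          using h0 that by simp
      qed
      then have T0: "T \<longlonglongrightarrow> 0"
        unfolding T_def by simp
      have bnd: "norm (integral {a..a + real n} (f w) - integral {a..} (f w)) \<le> T n" if w: "w \<in> cball s d" for w n
      proof -
        let ?g = "\<lambda>t. if t \<in> {a..a + real n} then f w t else 0"
        have eq: "{a..a + real n} \<inter> {a..} = {a..a + real n}"
          by auto
        have 1: "?g integrable_on {a..}" "integral {a..} ?g = integral {a..a + real n} (f w)"
          using integrable_continuous_real[OF cs[OF sub[OF w] Icc_subset_Ici_iff[THEN iffD2]]]
          by (simp_all only: integrable_restrict_Int integral_restrict_Int eq) auto
        have "integral {a..a + real n} (f w) - integral {a..} (f w) = integral {a..} (\<lambda>t. ?g t - f w t)"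
          unfolding 1(2)[symmetric] by (rule integral_diff[symmetric]) (use 1 ii sub w in auto)
        also have "norm \<dots> \<le> T n"
          unfolding T_def
          by (rule integral_norm_bound_integral[OF integrable_diff[OF 1(1) ii] hI])
             (use le w sub in auto)
        finally show ?thesis .
      qed
      have "uniform_limit (cball s d) (\<lambda>n s. integral {a..a + real n} (f s)) (\<lambda>s. integral {a..} (f s)) sequentially"
      proof (rule uniform_limitI)
        fix e :: real assume "e > 0"
        with T0 have "\<forall>\<^sub>F n in sequentially. T n < e"
          by (rule order_tendstoD)
        then show "\<forall>\<^sub>F n in sequentially. \<forall>w\<in>cball s d.
                     dist (integral {a..a + real n} (f w)) (integral {a..} (f w)) < e"
          by eventually_elim (auto simp: dist_norm intro: le_less_trans[OF bnd])
      qed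
      then show ?thesis
        using d sub by blast
    qed
  qed
qed

section \<open>Bernoulli numbers\<close>

text \<open>The Taylor coefficients at 0 of \<open>1 / (exp t - 1) - 1 / t\<close>: subtracting the
  pole uses up \<open>bernoulli 0\<close> and shifts the index by one. Up to the factor
  \<open>(-1) ^ k * fact k\<close> they are the values of zeta at \<open>- k\<close>.\<close>

definition bernoulli_coeff :: "nat \<Rightarrow> real" where
  "bernoulli_coeff m = bernoulli (Suc m) / fact (Suc m)"

lemma bernoulli_0: "bernoulli 0 = 1"
proof -
  have "fps_nth ((fps_exp 1 - 1) * Abs_fps (\<lambda>n. bernoulli n / fact n)) 1 = 1"
    by (simp only: bernoulli_generating_function) simp
  then show ?thesis
    by (simp add: fps_mult_nth)
qed

text \<open>Since \<open>exp t / (exp t - 1) = 1 + 1 / (exp t - 1)\<close>, replacing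
  \<open>t\<close> by \<open>- t\<close> in \<open>t / (exp t - 1)\<close> adds exactly
  \<open>t\<close>. Only the number with index 1 feels it, and the later odd ones vanish.\<close>

lemma bernoulli_reflect: "bernoulli n * (-1) ^ n = bernoulli n + (if n = 1 then 1 else 0)"
proof -
  let ?C = "Abs_fps (\<lambda>n. bernoulli n / fact n)" and ?E = "fps_exp 1 - 1 :: real fps"
  let ?D = "?C oo (fps_const (-1) * fps_X)"
  have E: "?E oo (fps_const (-1) * fps_X) = fps_exp (-1) - 1"
    by (simp add: fps_compose_sub_distrib del: fps_const_neg)
  have "(?E * ?C) oo (fps_const (-1) * fps_X) = - fps_X"
    unfolding bernoulli_generating_function by simp
  then have "(fps_exp (-1) - 1) * ?D = - fps_X"
    by (subst (asm) fps_compose_mult_distrib) (simp add: fps_mult_nth, simp only: E)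
  then have "fps_exp 1 * (fps_exp (-1) - 1) * ?D = fps_exp 1 * (- fps_X)"
    by (simp only: mult.assoc)
  moreover have "fps_exp 1 * (fps_exp (-1) - 1) = - ?E"
    by (simp add: algebra_simps flip: fps_exp_add_mult)
  ultimately have "- ?E * ?D = fps_exp 1 * (- fps_X)"
    by simp
  then have "?E * ?D = fps_exp 1 * fps_X"
    by (simp only: mult_minus_left mult_minus_right neg_equal_iff_equal)
  then have "?E * ?D = (?E + 1) * fps_X"
    by simp
  then have "?E * (?D - fps_X) = ?E * ?C"
    unfolding bernoulli_generating_function by (simp add: algebra_simps)
  moreover have "?E \<noteq> 0"
    by (auto simp: fps_eq_iff intro!: exI[of _ 1])
  ultimately have "?D - fps_X = ?C"
    by simp
  then have "fps_nth (?D - fps_X) n = fps_nth ?C n"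
    by simp
  then have "(-1) ^ n * (bernoulli n / fact n) - (if n = 1 then 1 else 0) = bernoulli n / fact n"
    by (subst (asm) fps_compose_linear) simp
  then show ?thesis
    by (auto simp: field_simps split: if_splits)
qed

lemma bernoulli_coeff_reflect: "m \<ge> 1 \<Longrightarrow> (-1) ^ m * bernoulli_coeff m = - bernoulli_coeff m"
proof -
  assume "m \<ge> 1"
  then have "(-1) ^ m * bernoulli (Suc m) = - bernoulli (Suc m)"
    using bernoulli_reflect[of "Suc m"] by (simp add: mult.commute)
  then show ?thesis
    unfolding bernoulli_coeff_def times_divide_eq_right by simp
qed

text \<open>The zeros of \<open>exp w - 1\<close> are the multiples of \<open>2 * pi * \<i>\<close>;
  once the one at 0 is divided out, the reciprocal is holomorphic in the disc of radius
  \<open>2 * pi\<close>. Its Taylor series solves the equation that defines the formal quotient, and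
  that solution is unique.\<close>

lemma bernoulli_sums_complex:
  assumes w: "norm w < 2 * pi"
  shows "(\<lambda>n. complex_of_real (bernoulli n / fact n) * w ^ n) sums (if w = 0 then 1 else w / (exp w - 1))"
proof -
  define E :: "complex \<Rightarrow> complex" where "E w = (if w = 0 then 1 else (exp w - 1) / w)" for w
  define F where "F w = inverse (E w)" for w
  \<comment> \<open>\<open>E\<close> is the difference quotient of \<open>exp\<close> at 0, whose
    singularity is removable.\<close>
  have "(\<lambda>w. if w = 0 then deriv exp 0 else (exp w - exp 0) / (w - 0)) holomorphic_on (UNIV :: complex set)"
    by (intro pole_lemma_open holomorphic_intros) auto
  also have "(\<lambda>w. if w = 0 then deriv exp 0 else (exp w - exp 0) / (w - 0)) = E"
    using DERIV_imp_deriv[OF DERIV_exp[of "0::complex"]] by (simp add: E_def fun_eq_iff)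
  finally have E: "E holomorphic_on UNIV" .
  have E0: "E w \<noteq> 0" if "w \<in> ball 0 (2 * pi)" for w
  proof
    assume "E w = 0"
    then have "w \<noteq> 0" "exp w = 1"
      by (auto simp: E_def split: if_splits)
    then obtain n :: int where n: "Re w = 0" "Im w = of_int (2 * n) * pi"
      by (auto simp: exp_eq_1)
    with \<open>w \<noteq> 0\<close> have "n \<noteq> 0"
      by (auto simp: complex_eq_iff)
    then have "\<bar>real_of_int n\<bar> \<ge> 1"
      by linarith
    with n have "norm w \<ge> 2 * pi"
      by (simp add: cmod_def abs_mult)
    with that show False
      by simp
  qed
  have F: "F holomorphic_on ball 0 (2 * pi)"
    unfolding F_def using E0 by (intro holomorphic_intros holomorphic_on_subset[OF E]) auto
  define C where "C = fps_expansion F 0"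
  have "F has_fps_expansion C"
    unfolding C_def using F by (intro has_fps_expansion_fps_expansion[of "ball 0 (2 * pi)"]) auto
  then have "(\<lambda>w. (exp w - 1) * F w) has_fps_expansion (fps_exp 1 - 1) * C"
    by (intro fps_expansion_intros)
  moreover have "\<forall>\<^sub>F w in nhds 0. (exp w - 1) * F w = w"
  proof -
    have "\<forall>\<^sub>F w in nhds 0. w \<in> ball 0 (2 * pi) "
      by (intro eventually_nhds_in_open) auto
    then show ?thesis
    proof eventually_elim
      case (elim w)
      with E0[OF elim] show ?case
        by (simp add: F_def E_def divide_simps split: if_splits)
    qed
  qed
  ultimately have "(\<lambda>w. w) has_fps_expansion (fps_exp 1 - 1) * C"
    by (simp add: has_fps_expansion_cong)
  then have 1: "(fps_exp 1 - 1) * C = fps_X"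
    using fps_expansion_unique_complex has_fps_expansion_fps_X by blast
  have 2: "(fps_exp 1 - 1) * Abs_fps (\<lambda>n. complex_of_real (bernoulli n / fact n)) = fps_X"
  proof (rule fps_ext)
    fix n
    have *: "complex_of_real (fps_nth ((fps_exp 1 - 1) * Abs_fps (\<lambda>n. bernoulli n / fact n)) n) =
          fps_nth ((fps_exp 1 - 1) * Abs_fps (\<lambda>n. complex_of_real (bernoulli n / fact n))) n"
      by (simp add: fps_mult_nth if_distrib[of complex_of_real] cong: if_cong)
    show "fps_nth ((fps_exp 1 - 1) * Abs_fps (\<lambda>n. complex_of_real (bernoulli n / fact n))) n = fps_nth fps_X n"
      unfolding *[symmetric] bernoulli_generating_function by simp
  qed
  have "fps_exp 1 - 1 \<noteq> (0 :: complex fps)"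
    by (auto simp: fps_eq_iff intro!: exI[of _ 1])
  with 1 2 have C: "C = Abs_fps (\<lambda>n. complex_of_real (bernoulli n / fact n))"
    by (metis mult_left_cancel)
  have "(\<lambda>n. (deriv ^^ n) F 0 / fact n * (w - 0) ^ n) sums F w"
    using w F by (intro holomorphic_power_series[of F 0 "2 * pi"]) auto
  moreover have "(deriv ^^ n) F 0 / fact n = complex_of_real (bernoulli n / fact n)" for n
    using arg_cong[OF C, of "\<lambda>f. fps_nth f n"] by (simp add: C_def fps_expansion_def)
  moreover have "F w = (if w = 0 then 1 else w / (exp w - 1))"
    by (simp add: F_def E_def)
  ultimately show ?thesis
    by simp
qed

text \<open>The common majorant for exchanging limits in Bernoulli series whose argument is bounded
  by \<open>pi\<close>.\<close>

lemma summable_bernoulli_coeff: "summable (\<lambda>m. \<bar>bernoulli_coeff m\<bar> * pi ^ m)"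
proof -
  \<comment> \<open>A radius strictly between \<open>pi\<close> and \<open>2 * pi\<close>:
    convergence there implies absolute convergence at \<open>pi\<close>.\<close>
  have "summable (\<lambda>n. complex_of_real (bernoulli n / fact n) * of_real (3 / 2 * pi) ^ n)"
    using bernoulli_sums_complex[of "of_real (3 / 2 * pi)"] by (simp add: sums_iff del: of_real_mult)
  then have "summable (\<lambda>n. norm (complex_of_real (bernoulli n / fact n) * of_real pi ^ n))"
    by (rule powser_insidea) simp
  then have "summable (\<lambda>n. norm (complex_of_real (bernoulli (Suc n) / fact (Suc n)) * of_real pi ^ Suc n))"
    by (rule summable_Suc_iff[THEN iffD2])
  then have "summable (\<lambda>n. norm (complex_of_real (bernoulli (Suc n) / fact (Suc n)) * of_real pi ^ Suc n) * inverse pi)"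
    by (rule summable_mult2)
  moreover have "norm (complex_of_real (bernoulli (Suc n) / fact (Suc n)) * of_real pi ^ Suc n) * inverse pi
     = \<bar>bernoulli_coeff n\<bar> * pi ^ n" for n
    by (simp add: norm_mult norm_power bernoulli_coeff_def norm_divide field_simps del: fact_Suc of_real_divide)
  ultimately show ?thesis
    by simp
qed

lemma bernoulli_coeff_sums:
  assumes "t \<noteq> 0" "\<bar>t\<bar> < 2 * pi"
  shows "(\<lambda>m. bernoulli_coeff m * t ^ m) sums (1 / (exp t - 1) - 1 / t)"
proof -
  have "(\<lambda>n. complex_of_real (bernoulli n / fact n * t ^ n)) sums (complex_of_real (t / (exp t - 1)))"
    using bernoulli_sums_complex[of "of_real t"] assms by (simp flip: exp_of_real)
  then have "(\<lambda>n. bernoulli n / fact n * t ^ n) sums (t / (exp t - 1))"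
    by (simp only: sums_of_real_iff)
  then have "(\<lambda>n. bernoulli (Suc n) / fact (Suc n) * t ^ Suc n) sums (t / (exp t - 1) - 1)"
    by (subst sums_Suc_iff) (simp add: bernoulli_0)
  then have "(\<lambda>n. bernoulli (Suc n) / fact (Suc n) * t ^ Suc n * inverse t) sums ((t / (exp t - 1) - 1) * inverse t)"
    by (rule sums_mult2)
  then show ?thesis
    using assms(1) by (simp add: bernoulli_coeff_def field_simps del: fact_Suc)
qed

section \<open>Continuation of the zeta function\<close>

text \<open>A point \<open>- of_nat m\<close> is excluded only if \<open>d m\<close> is nonzero.
  Setting one coefficient to 0 therefore makes the series holomorphic at that point, which is how
  the continuation is studied near a nonpositive integer.\<close>

lemma holomorphic_on_partial_fraction_series:
  fixes d :: "nat \<Rightarrow> complex"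
  assumes d: "summable (\<lambda>m. norm (d m))"
  defines "S \<equiv> {s. \<forall>m. d m \<noteq> 0 \<longrightarrow> s \<noteq> - of_nat m}"
  shows "(\<lambda>s. \<Sum>m. d m / (s + of_nat m)) holomorphic_on S"
    and "s \<in> S \<Longrightarrow> summable (\<lambda>m. norm (d m / (s + of_nat m)))"
    and "open S"
proof -
  have "S = - ((\<lambda>m. - of_nat m) ` {m. d m \<noteq> 0})"
    by (auto simp: S_def)
  then show S: "open S"
    by (auto intro!: closed_subset_Ints)
  have ex: "\<exists>\<delta>>0. cball x \<delta> \<subseteq> S \<and> (\<forall>s\<in>cball x \<delta>. \<forall>m. norm (d m / (s + of_nat m)) \<le> norm (d m) / \<delta>)"
    if x: "x \<in> S" for x
  proof -
    from S x obtain \<epsilon> where \<epsilon>: "\<epsilon> > 0" "cball x \<epsilon> \<subseteq> S"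
      by (meson open_contains_cball)
    \<comment> \<open>Every pole lies outside the disc of radius \<open>\<epsilon>\<close>, so
      points of the half-sized disc keep distance \<open>\<epsilon> / 2\<close> from all of them;
      this gives the bound for the Weierstrass test.\<close>
    have "norm (d m / (s + of_nat m)) \<le> norm (d m) / (\<epsilon> / 2)" if s: "s \<in> cball x (\<epsilon> / 2)" for s m
    proof (cases "d m = 0")
      case False
      then have "- of_nat m \<notin> S"
        by (auto simp: S_def)
      with \<epsilon> have "- of_nat m \<notin> cball x \<epsilon>"
        by blast
      then have "dist x (- of_nat m) > \<epsilon>"
        by simp
      moreover have "dist x (- of_nat m) \<le> dist x s + dist s (- of_nat m)"
        by (rule dist_triangle)
      ultimately have "dist s (- of_nat m) \<ge> \<epsilon> / 2"
        using s by simp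
      then have "norm (s + of_nat m) \<ge> \<epsilon> / 2"
        by (simp add: dist_norm)
      then show ?thesis
        unfolding norm_divide using \<epsilon> by (intro divide_left_mono mult_pos_pos) auto
    qed simp
    moreover have "cball x (\<epsilon> / 2) \<subseteq> S"
      using \<epsilon> by (intro order_trans[OF _ \<epsilon>(2)]) auto
    ultimately show ?thesis
      using \<epsilon> by (intro exI[of _ "\<epsilon> / 2"]) auto
  qed
  show "summable (\<lambda>m. norm (d m / (s + of_nat m)))" if s: "s \<in> S"
  proof -
    obtain \<delta> where "\<delta> > 0" "\<forall>m. norm (d m / (s + of_nat m)) \<le> norm (d m) / \<delta>"
      using ex[OF s] by (metis centre_in_cball less_imp_le)
    then show ?thesis
      by (intro summable_comparison_test'[OF summable_divide[OF d, of \<delta>]]) simp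
  qed
  show "(\<lambda>s. \<Sum>m. d m / (s + of_nat m)) holomorphic_on S"
  proof (rule holomorphic_uniform_sequence[OF S])
    show "(\<lambda>s. \<Sum>m<n. d m / (s + of_nat m)) holomorphic_on S" for n
    proof (intro holomorphic_on_sum)
      show "(\<lambda>s. d m / (s + of_nat m)) holomorphic_on S" for m
      proof (cases "d m = 0")
        case False
        then have "s + of_nat m \<noteq> 0" if "s \<in> S" for s
          using that by (auto simp: S_def add_eq_0_iff2)
        then show ?thesis
          by (intro holomorphic_intros) auto
      qed simp
    qed
    show "\<exists>\<delta>>0. cball x \<delta> \<subseteq> S \<and> uniform_limit (cball x \<delta>)
            (\<lambda>n s. \<Sum>m<n. d m / (s + of_nat m)) (\<lambda>s. \<Sum>m. d m / (s + of_nat m)) sequentially"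
      if x: "x \<in> S" for x
    proof -
      obtain \<delta> where \<delta>: "\<delta> > 0" "cball x \<delta> \<subseteq> S"
        "\<forall>s\<in>cball x \<delta>. \<forall>m. norm (d m / (s + of_nat m)) \<le> norm (d m) / \<delta>"
        using ex[OF x] by blast
      then have "uniform_limit (cball x \<delta>) (\<lambda>n s. \<Sum>m<n. d m / (s + of_nat m))
            (\<lambda>s. \<Sum>m. d m / (s + of_nat m)) sequentially"
        by (intro Weierstrass_m_test[OF _ summable_divide[OF d]]) auto
      with \<delta> show ?thesis
        by blast
    qed
  qed
qed

section \<open>Mellin integrals of exponentials and powers\<close>

lemma has_integral_Gamma_scaled:
  fixes s :: complex
  assumes s: "Re s > 0" and a: "a > 0"
  shows "((\<lambda>t. of_real t powr (s - 1) * of_real (exp (- (a * t)))) has_integral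
           Gamma s / of_real a powr s) {0<..}"
proof -
  let ?f = "\<lambda>t. complex_of_real t powr (s - 1) / of_real (exp t)"
  have "?f absolutely_integrable_on {0<..}"
    using absolutely_integrable_Gamma_integral[OF s, of 1] by simp
  moreover have "integral {0<..} ?f = Gamma s"
    using Gamma_integral_complex'[OF s] by (rule integral_unique)
  moreover have "(\<lambda>t. a * t) ` {0<..} = {0<..}"
  proof safe
    fix x :: real assume "x > 0"
    then show "x \<in> (\<lambda>t. a * t) ` {0<..}"
      using a by (intro image_eqI[of _ _ "x / a"]) auto
  qed (use a in auto)
  ultimately have *: "(\<lambda>t. \<bar>a\<bar> *\<^sub>R ?f (a * t)) absolutely_integrable_on {0<..} \<and>
             integral {0<..} (\<lambda>t. \<bar>a\<bar> *\<^sub>R ?f (a * t)) = Gamma s"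
    using a by (subst has_absolute_integral_change_of_variables_real[where g = "\<lambda>t. a * t"])
      (auto intro!: derivative_eq_intros inj_onI)
  then have "((\<lambda>t. \<bar>a\<bar> *\<^sub>R ?f (a * t)) has_integral Gamma s) {0<..}"
    using set_lebesgue_integral_eq_integral(1) has_integral_integrable_integral by blast
  then have "((\<lambda>t. (\<bar>a\<bar> *\<^sub>R ?f (a * t)) / of_real a powr s) has_integral Gamma s / of_real a powr s) {0<..}"
    by (rule has_integral_divide)
  then show ?thesis
  proof (rule has_integral_eq[rotated])
    fix t :: real assume "t \<in> {0<..}"
    then show "(\<bar>a\<bar> *\<^sub>R ?f (a * t)) / of_real a powr s = of_real t powr (s - 1) * of_real (exp (- (a * t)))"
      using a by (simp add: powr_times_real powr_diff exp_minus field_simps scaleR_conv_of_real)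
  qed
qed

lemma has_integral_Gamma_scaled_real:
  fixes x :: real
  assumes "x > 0" "a > 0"
  shows "((\<lambda>t. t powr (x - 1) * exp (- (a * t))) has_integral Gamma x / a powr x) {0<..}"
proof -
  have "((\<lambda>t. Re (of_real t powr (of_real x - 1) * of_real (exp (- (a * t))))) has_integral
          Re (Gamma (of_real x) / of_real a powr of_real x)) {0<..}"
    using has_integral_Gamma_scaled[of "of_real x" a] assms by (intro has_integral_Re) auto
  also have "Re (Gamma (of_real x) / of_real a powr of_real x) = Gamma x / a powr x"
    using assms by (simp add: Gamma_complex_of_real powr_of_real)
  finally show ?thesis
  proof (rule has_integral_eq[rotated])
    fix t :: real assume "t \<in> {0<..}"
    then have "complex_of_real t powr (of_real x - 1) = of_real (t powr (x - 1))"
      using powr_of_real[of t "x - 1"] by simp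
    then show "Re (complex_of_real t powr (of_real x - 1) * of_real (exp (- (a * t)))) = t powr (x - 1) * exp (- (a * t))"
      by simp
  qed
qed

lemma has_integral_powr_complex:
  fixes s :: complex
  assumes "Re s > 0" "c > 0"
  shows "((\<lambda>t. of_real t powr (s - 1)) has_integral of_real c powr s / s) {0<..c}"
proof -
  have "((\<lambda>t. of_real t powr (s - 1)) has_integral (of_real c powr s / s - of_real 0 powr s / s)) {0..c}"
  proof (intro fundamental_theorem_of_calculus_interior)
    show "continuous_on {0..c} (\<lambda>t. of_real t powr s / s)"
      using assms by (intro continuous_intros) auto
    show "((\<lambda>t. of_real t powr s / s) has_vector_derivative of_real t powr (s - 1)) (at t)" if "t \<in> {0<..<c}" for t
      using that assms by (auto intro!: derivative_eq_intros has_vector_derivative_real_field)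
  qed (use assms in auto)
  then show ?thesis
    using assms by (subst has_integral_spike_set_eq[of "{0<..c}" "{0..c}"])
      (auto intro: negligible_subset[of "{0}"])
qed

section \<open>The continued Mellin transform and its poles\<close>

definition zeta_tail :: "complex \<Rightarrow> complex" where
  "zeta_tail s = integral {pi..} (\<lambda>t. of_real t powr (s - 1) / of_real (exp t - 1))"

lemma two_le_exp: "t \<ge> pi \<Longrightarrow> 2 \<le> exp (t :: real)"
  using exp_ge_add_one_self[of t] pi_gt3 by linarith

text \<open>Exponential decay beats every power of \<open>t\<close> and the range stays away from 0,
  so the tail carries no pole.\<close>

lemma zeta_tail_holomorphic: "zeta_tail holomorphic_on UNIV"
  and zeta_tail_integrable:
    "(\<lambda>t. of_real t powr (s - 1) / complex_of_real (exp t - 1)) absolutely_integrable_on {pi..}"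
proof -
  define f where "f s t = exp ((s - 1) * of_real (ln t)) / complex_of_real (exp t - 1)" for s t
  define f' where "f' s t = exp ((s - 1) * of_real (ln t)) * of_real (ln t) / complex_of_real (exp t - 1)" for s t
  have pos: "t > 0" if "t \<ge> pi" for t
    using that pi_gt_zero by linarith
  have eq: "of_real t powr (s - 1) / of_real (exp t - 1) = f s t" if "t \<in> {pi..}" for s t
    using pos[of t] that by (simp add: f_def powr_def Ln_of_real mult_ac)
  have nz: "exp t \<noteq> 1" if "t \<ge> pi" for t :: real
    using pos[OF that] by simp
  then have nz': "complex_of_real (exp t) \<noteq> 1" if "t \<ge> pi" for t
    using that by (simp del: of_real_exp)
  have f': "((\<lambda>s. f s t) has_field_derivative f' s t) (at s)" if "t \<ge> pi" for s t
    unfolding f_def f'_def using nz'[OF that]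
    by (auto intro!: derivative_eq_intros)
  have cont: "continuous_on (UNIV \<times> {pi..}) (\<lambda>(s, t). f s t)"
    unfolding f_def case_prod_unfold using pos nz'
    by (intro continuous_intros) force+
  have cont': "continuous_on (UNIV \<times> {pi..}) (\<lambda>(s, t). f' s t)"
    unfolding f'_def case_prod_unfold using pos nz'
    by (intro continuous_intros) force+
  have dom: "\<exists>d>0. \<exists>h. h integrable_on {pi..} \<and>
                (\<forall>w\<in>cball s d. \<forall>t\<ge>pi. w \<in> UNIV \<and> norm (f w t) \<le> h t)" for s
  proof -
    \<comment> \<open>On the unit disc around \<open>s\<close>, \<open>Re w - 1\<close> is at most
      \<open>A\<close>; the maximum with 1 keeps the Gamma integral at \<open>A + 1\<close>
      convergent. The factor 2 in \<open>h\<close> pays for replacing \<open>exp t - 1\<close> by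
      \<open>exp t\<close>.\<close>
    define A where "A = max 1 (Re s)"
    define h where "h t = 2 * (t powr A / exp t)" for t :: real
    have "(\<lambda>t. t powr (A + 1 - 1) / exp t) integrable_on {0..}"
      using has_integral_integrable[OF Gamma_integral_real[of "A + 1"]] by (simp add: A_def)
    then have "(\<lambda>t. t powr A / exp t) absolutely_integrable_on {0..}"
      by (subst absolutely_integrable_on_iff_nonneg) auto
    then have "(\<lambda>t. t powr A / exp t) absolutely_integrable_on {pi..}"
      by (rule set_integrable_subset) auto
    then have "h integrable_on {pi..}"
      unfolding h_def by (intro integrable_on_mult_right set_lebesgue_integral_eq_integral(1))
    moreover have "norm (f w t) \<le> h t" if "w \<in> cball s 1" "t \<ge> pi" for w t
    proof -
      have t: "t > 1" "exp t \<ge> 2"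
        using that pi_gt3 two_le_exp by auto
      have "Re w - Re s \<le> norm (w - s)"
        using complex_Re_le_cmod[of "w - s"] by simp
      also have "\<dots> \<le> 1"
        using that by (simp add: dist_norm norm_minus_commute)
      finally have "Re w - 1 \<le> A"
        by (simp add: A_def)
      then have "exp ((Re w - 1) * ln t) \<le> t powr A"
        using t by (simp add: powr_def)
      moreover have "exp t / 2 \<le> exp t - 1"
        using t by simp
      ultimately have "exp ((Re w - 1) * ln t) / (exp t - 1) \<le> t powr A / (exp t / 2)"
        using t by (intro frac_le) auto
      also have "exp ((Re w - 1) * ln t) / (exp t - 1) = norm (f w t)"
        using t by (simp add: f_def norm_divide del: of_real_diff)
      finally show ?thesis
        by (simp add: h_def mult.commute)
    qed
    ultimately show ?thesis
      by (intro exI[of _ 1] conjI exI[of _ h]) auto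
  qed
  have 1: "(\<lambda>s. integral {pi..} (f s)) holomorphic_on UNIV"
    and 2: "f s absolutely_integrable_on {pi..}" for s
    by (rule holomorphic_on_integral_dominated[of UNIV pi f f', OF _ f' cont cont' dom]; simp)+
  have "zeta_tail = (\<lambda>s. integral {pi..} (f s))"
    unfolding zeta_tail_def by (intro ext integral_cong eq)
  with 1 show "zeta_tail holomorphic_on UNIV"
    by simp
  show "(\<lambda>t. of_real t powr (s - 1) / of_real (exp t - 1)) absolutely_integrable_on {pi..}"
  proof -
    have "(\<lambda>t. of_real t powr (s - 1) / complex_of_real (exp t - 1)) absolutely_integrable_on {pi..} \<longleftrightarrow>
          f s absolutely_integrable_on {pi..}"
      by (intro set_integrable_cong eq refl)
    with 2 show ?thesis
      by blast
  qed
qed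

text \<open>The integral of \<open>t powr (s - 1) / (exp t - 1)\<close> over \<open>{0<..}\<close>, with the part over \<open>{0<..pi}\<close>
  replaced by the termwise integral of its expansion at \<open>0\<close>. The terms of the coefficients \<open>d\<close>
  carry the poles at the integers \<open>s \<le> 0\<close>.\<close>

definition zeta_mellin :: "(nat \<Rightarrow> complex) \<Rightarrow> complex \<Rightarrow> complex" where
  "zeta_mellin d s = of_real pi powr (s - 1) / (s - 1)
     + of_real pi powr s * (\<Sum>m. d m / (s + of_nat m)) + zeta_tail s"

text \<open>Integrating \<open>t powr (s + m - 1)\<close> over \<open>{0<..pi}\<close> gives
  \<open>pi powr (s + m) / (s + m)\<close>. The factor \<open>pi ^ m\<close> stays with the
  coefficient, so that \<open>pi powr s\<close> can be taken out of the series.\<close>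

definition mellin_coeff :: "nat \<Rightarrow> complex" where
  "mellin_coeff m = of_real (bernoulli_coeff m * pi ^ m)"

text \<open>At \<open>s = - k\<close> the first branch is the limit of the second one.\<close>

definition zeta_cont :: "complex \<Rightarrow> complex" where
  "zeta_cont s = (if s \<in> \<int>\<^sub>\<le>\<^sub>0 then let k = nat \<lfloor>- Re s\<rfloor> in of_real ((-1) ^ k * fact k * bernoulli_coeff k)
     else rGamma s * zeta_mellin mellin_coeff s)"

lemma summable_mellin_coeff: "summable (\<lambda>m. norm (mellin_coeff m))"
  using summable_bernoulli_coeff by (simp add: mellin_coeff_def norm_mult norm_power abs_mult)

lemma zeta_mellin_holomorphic:
  assumes "summable (\<lambda>m. norm (d m))"
  shows "zeta_mellin d holomorphic_on ({s. \<forall>m. d m \<noteq> 0 \<longrightarrow> s \<noteq> - of_nat m} - {1})"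
  unfolding zeta_mellin_def[abs_def]
  by (intro holomorphic_intros holomorphic_on_subset[OF zeta_tail_holomorphic]
        holomorphic_on_subset[OF holomorphic_on_partial_fraction_series(1)[OF assms]]) auto

text \<open>Isolates the only term that can be singular at \<open>- of_nat k\<close>; the remainder
  is holomorphic there.\<close>

lemma zeta_mellin_remove_term:
  assumes s: "s \<notin> \<int>\<^sub>\<le>\<^sub>0"
  shows "zeta_mellin mellin_coeff s =
    of_real pi powr s * (mellin_coeff k / (s + of_nat k)) + zeta_mellin (mellin_coeff(k := 0)) s"
proof -
  have "s \<noteq> - of_nat m" for m
    using s by auto
  then have sum: "summable (\<lambda>m. mellin_coeff m / (s + of_nat m))"
    using holomorphic_on_partial_fraction_series(2)[OF summable_mellin_coeff, of s]
    by (auto intro: summable_norm_cancel)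
  have "(\<lambda>m. mellin_coeff m / (s + of_nat m) - (if m = k then mellin_coeff k / (s + of_nat k) else 0)) sums
          ((\<Sum>m. mellin_coeff m / (s + of_nat m)) - mellin_coeff k / (s + of_nat k))"
    using sums_single[of k "\<lambda>_. mellin_coeff k / (s + of_nat k)"]
    by (intro sums_diff summable_sums sum)
  also have "(\<lambda>m. mellin_coeff m / (s + of_nat m) - (if m = k then mellin_coeff k / (s + of_nat k) else 0))
    = (\<lambda>m. (mellin_coeff(k := 0)) m / (s + of_nat m))"
    by auto
  finally have "(\<Sum>m. mellin_coeff m / (s + of_nat m)) =
      mellin_coeff k / (s + of_nat k) + (\<Sum>m. (mellin_coeff(k := 0)) m / (s + of_nat m))"
    by (simp add: sums_iff)
  then show ?thesis
    unfolding zeta_mellin_def by (simp only: distrib_left add_ac)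
qed

text \<open>\<open>rGamma\<close> with its zero at \<open>-k\<close> divided out.\<close>

definition rGamma_cofactor :: "nat \<Rightarrow> complex \<Rightarrow> complex" where
  "rGamma_cofactor k s = pochhammer s k * rGamma (s + of_nat (Suc k))"

lemma rGamma_eq_cofactor: "rGamma s = (s + of_nat k) * rGamma_cofactor k s"
  unfolding rGamma_cofactor_def pochhammer_rGamma[of s "Suc k"] pochhammer_Suc by (simp add: mult_ac)

lemma rGamma_cofactor_at: "rGamma_cofactor k (- of_nat k) = (-1) ^ k * fact k"
  by (simp add: rGamma_cofactor_def pochhammer_same)

text \<open>The zero of \<open>rGamma\<close> at \<open>- of_nat k\<close> cancels the pole of the
  partial fraction with index \<open>k\<close>, so the right-hand side makes sense on the whole
  disc. At the centre it reproduces the value prescribed in \<open>zeta_cont\<close>, because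
  \<open>rGamma\<close> kills the second summand.\<close>

lemma zeta_cont_near:
  assumes s: "s \<in> ball (- of_nat k) 1"
  shows "zeta_cont s = rGamma_cofactor k s * of_real pi powr s * mellin_coeff k +
           rGamma s * zeta_mellin (mellin_coeff(k := 0)) s"
proof (cases "s = - of_nat k")
  case True
  have "nat \<lfloor>- Re s\<rfloor> = k"
    using True by simp
  moreover have "s \<in> \<int>\<^sub>\<le>\<^sub>0"
    using True by simp
  moreover have "complex_of_real pi powr - of_nat k * of_real pi ^ k = 1"
    by (simp add: powr_minus powr_nat')
  ultimately show ?thesis
    by (simp add: zeta_cont_def True rGamma_cofactor_at mellin_coeff_def mult_ac)
next
  case False
  have "s \<notin> \<int>\<^sub>\<le>\<^sub>0"
  proof
    assume "s \<in> \<int>\<^sub>\<le>\<^sub>0"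
    then obtain n where "s = - of_nat n"
      by (auto elim: nonpos_Ints_cases')
    with s have "norm (of_int (int n - int k) :: complex) < 1"
      by (simp add: dist_norm)
    then have "\<bar>int n - int k\<bar> < 1"
      unfolding norm_of_int by linarith
    with False \<open>s = - of_nat n\<close> show False
      by simp
  qed
  then show ?thesis
    using False rGamma_eq_cofactor[of s k]
    by (simp add: zeta_cont_def zeta_mellin_remove_term[of s k] add_eq_0_iff2 field_simps)
qed

lemma zeta_cont_holomorphic: "zeta_cont holomorphic_on (- {1})"
proof -
  have "\<exists>D. (zeta_cont has_field_derivative D) (at s)" if s: "s \<noteq> 1" for s
  proof (cases "s \<in> \<int>\<^sub>\<le>\<^sub>0")
    case True
    then obtain k where k: "s = - of_nat k"
      by (auto elim: nonpos_Ints_cases')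
    have sub: "ball s 1 \<subseteq> {s. \<forall>m. (mellin_coeff(k := 0)) m \<noteq> 0 \<longrightarrow> s \<noteq> - of_nat m} - {1}"
    proof safe
      fix m assume "- of_nat m \<in> ball s 1" "(mellin_coeff(k := 0)) m \<noteq> 0"
      then have "norm (of_int (int m - int k) :: complex) < 1" "m \<noteq> k"
        by (auto simp: dist_norm k split: if_splits)
      then show False
        unfolding norm_of_int by linarith
    next
      assume "1 \<in> ball s 1"
      then have "norm (of_nat (Suc k) :: complex) < 1"
        by (simp add: dist_norm k norm_minus_commute)
      then show False
        unfolding norm_of_nat by simp
    qed
    have "summable (\<lambda>m. norm ((mellin_coeff(k := 0)) m))"
      by (rule summable_comparison_test'[OF summable_mellin_coeff]) auto
    then have "(\<lambda>s. rGamma_cofactor k s * of_real pi powr s * mellin_coeff k +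
           rGamma s * zeta_mellin (mellin_coeff(k := 0)) s) holomorphic_on ball s 1"
      unfolding rGamma_cofactor_def[abs_def]
      by (intro holomorphic_intros holomorphic_on_subset[OF zeta_mellin_holomorphic sub]) auto
    then have "zeta_cont holomorphic_on ball s 1"
      by (rule holomorphic_transform) (use zeta_cont_near k in auto)
    then show ?thesis
      by (auto simp: holomorphic_on_open)
  next
    case False
    let ?U = "- \<int>\<^sub>\<le>\<^sub>0 - {1} :: complex set"
    have U: "open ?U"
      by (intro open_Diff) auto
    have "(\<lambda>s. rGamma s * zeta_mellin mellin_coeff s) holomorphic_on ?U"
      by (intro holomorphic_intros holomorphic_on_subset[OF zeta_mellin_holomorphic[OF summable_mellin_coeff]]) auto
    then have "zeta_cont holomorphic_on ?U"
      by (rule holomorphic_transform) (auto simp: zeta_cont_def)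
    then show ?thesis
      using U False s by (auto simp: holomorphic_on_open)
  qed
  then show ?thesis
    by (subst holomorphic_on_open) auto
qed

section \<open>Agreement with the Dirichlet series\<close>

lemma exp_geometric_sums: "t > 0 \<Longrightarrow> (\<lambda>n. exp (- (real (Suc n) * t))) sums (1 / (exp t - 1))"
proof -
  assume t: "t > 0"
  have "(\<lambda>n. exp (- t) * exp (- t) ^ n) sums (exp (- t) * (1 / (1 - exp (- t))))"
    using t by (intro sums_mult geometric_sums) simp
  also have "exp (- t) * (1 / (1 - exp (- t))) = 1 / (exp t - 1)"
    using t by (simp add: exp_minus divide_simps)
  also have "(\<lambda>n. exp (- t) * exp (- t) ^ n) = (\<lambda>n. exp (- (real (Suc n) * t)))"
    by (simp add: fun_eq_iff algebra_simps flip: exp_add exp_of_nat_mult)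
  finally show ?thesis .
qed

text \<open>Riemann's integral: each term of the geometric expansion of
  \<open>1 / (exp t - 1)\<close> gives a Gamma integral, and the same integrals at
  \<open>Re s\<close> are the summable majorants.\<close>

lemma Gamma_zeta_integral:
  assumes s: "Re s > 1"
  shows "summable (\<lambda>n. 1 / of_nat (Suc n) powr s)"
    and "((\<lambda>t. of_real t powr (s - 1) / of_real (exp t - 1)) has_integral
            Gamma s * (\<Sum>n. 1 / of_nat (Suc n) powr s)) {0<..}"
proof -
  define f where "f n t = of_real t powr (s - 1) * of_real (exp (- (real (Suc n) * t)))" for n t
  define h where "h n t = t powr (Re s - 1) * exp (- (real (Suc n) * t))" for n t
  have f: "(f n has_integral Gamma s / of_real (real (Suc n)) powr s) {0<..}" for n
    unfolding f_def using s by (intro has_integral_Gamma_scaled) auto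
  have h: "(h n has_integral Gamma (Re s) / real (Suc n) powr (Re s)) {0<..}" for n
    unfolding h_def using s by (intro has_integral_Gamma_scaled_real) auto
  have "summable (\<lambda>n. of_nat n powr (- Re s) :: real)"
    using s by (subst summable_real_powr_iff) auto
  then have "summable (\<lambda>n. of_nat (Suc n) powr (- Re s) :: real)"
    by (subst summable_Suc_iff)
  then have "summable (\<lambda>n. Gamma (Re s) * real (Suc n) powr (- Re s))"
    by (rule summable_mult)
  then have J: "summable (\<lambda>n. Gamma (Re s) / real (Suc n) powr (Re s))"
    by (simp add: powr_minus divide_inverse)
  have le: "norm (f n t) \<le> h n t" if "t \<in> {0<..}" for n t
    using that by (simp add: f_def h_def norm_mult norm_powr_real_powr)
  have hsum: "summable (\<lambda>n. h n t)" if "t \<in> {0<..}" for t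
    unfolding h_def using that exp_geometric_sums[of t] by (intro summable_mult) (auto simp: sums_iff)
  have fsum: "(\<lambda>n. f n t) sums (of_real t powr (s - 1) * of_real (1 / (exp t - 1)))" if "t \<in> {0<..}" for t
    unfolding f_def using that by (intro sums_mult sums_of_real exp_geometric_sums) auto
  note main = has_integral_sums[OF f h J le hsum fsum]
  have "summable (\<lambda>n. Gamma s / of_real (real (Suc n)) powr s)"
    using main(1) by (rule summable_norm_cancel)
  \<comment> \<open>Convergence of the Dirichlet series is read off from that of the integrals,
    \<open>Gamma s\<close> being nonzero.\<close>
  then have "summable (\<lambda>n. inverse (Gamma s) * (Gamma s / of_real (real (Suc n)) powr s))"
    by (rule summable_mult)
  moreover have "Gamma s \<noteq> 0"
    using s by (auto simp: Gamma_eq_zero_iff elim!: nonpos_Ints_cases)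
  ultimately show sum: "summable (\<lambda>n. 1 / of_nat (Suc n) powr s)"
    by (simp add: field_simps)
  have "(\<Sum>n. Gamma s / of_real (real (Suc n)) powr s) = Gamma s * (\<Sum>n. 1 / of_nat (Suc n) powr s)"
    using suminf_mult[OF sum, of "Gamma s"] by simp
  with main(2) show "((\<lambda>t. of_real t powr (s - 1) / of_real (exp t - 1)) has_integral
            Gamma s * (\<Sum>n. 1 / of_nat (Suc n) powr s)) {0<..}"
    by (simp add: divide_inverse)
qed

text \<open>The polar part \<open>1 / t\<close> of \<open>1 / (exp t - 1)\<close> produces the term
  with denominator \<open>s - 1\<close>, and \<open>Re s > 1\<close> makes it converge at 0; the
  Taylor part is integrated term by term.\<close>

lemma Gamma_zeta_integral_near_0:
  assumes s: "Re s > 1"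
  shows "((\<lambda>t. of_real t powr (s - 1) / of_real (exp t - 1)) has_integral
            (of_real pi powr (s - 1) / (s - 1) +
             of_real pi powr s * (\<Sum>m. mellin_coeff m / (s + of_nat m)))) {0<..pi}"
proof -
  define f where "f m t = of_real (bernoulli_coeff m) * of_real t powr (s + of_nat m - 1)" for m t
  \<comment> \<open>Replacing \<open>t ^ m\<close> by \<open>pi ^ m\<close> leaves one fixed
    integrable power of \<open>t\<close> times a summable constant.\<close>
  define h where "h m t = \<bar>bernoulli_coeff m\<bar> * pi ^ m * t powr (Re s - 1)" for m t
  have f: "(f m has_integral of_real (bernoulli_coeff m) * (of_real pi powr (s + of_nat m) / (s + of_nat m))) {0<..pi}" for m
    unfolding f_def using s by (intro has_integral_mult_right has_integral_powr_complex) auto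
  have h: "(h m has_integral \<bar>bernoulli_coeff m\<bar> * pi ^ m * (pi powr (Re s) / Re s)) {0<..pi}" for m
  proof -
    have "((\<lambda>t. Re (of_real t powr (of_real (Re s) - 1))) has_integral Re (of_real pi powr of_real (Re s) / of_real (Re s))) {0<..pi}"
      using s by (intro has_integral_Re has_integral_powr_complex) auto
    also have "Re (of_real pi powr of_real (Re s) / of_real (Re s)) = pi powr (Re s) / Re s"
      by (simp add: powr_of_real)
    finally have "((\<lambda>t. t powr (Re s - 1)) has_integral pi powr (Re s) / Re s) {0<..pi}"
    proof (rule has_integral_eq[rotated])
      fix t assume "t \<in> {0<..pi}"
      then show "Re (of_real t powr (of_real (Re s) - 1)) = t powr (Re s - 1)"
        using powr_of_real[of t "Re s - 1"] by simp
    qed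
    then show ?thesis
      unfolding h_def by (rule has_integral_mult_right)
  qed
  have J: "summable (\<lambda>m. \<bar>bernoulli_coeff m\<bar> * pi ^ m * (pi powr (Re s) / Re s))"
    by (rule summable_mult2[OF summable_bernoulli_coeff])
  have le: "norm (f m t) \<le> h m t" if t: "t \<in> {0<..pi}" for m t
  proof -
    have "norm (f m t) = \<bar>bernoulli_coeff m\<bar> * t ^ m * t powr (Re s - 1)"
    proof -
      have "norm (f m t) = \<bar>bernoulli_coeff m\<bar> * t powr (real m + (Re s - 1))"
        using t by (simp add: f_def norm_mult norm_powr_real_powr algebra_simps)
      then show ?thesis
        using t by (simp only: powr_add) (simp add: powr_realpow)
    qed
    also have "\<dots> \<le> h m t"
      unfolding h_def using t by (intro mult_right_mono mult_left_mono power_mono) auto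
    finally show ?thesis .
  qed
  have hsum: "summable (\<lambda>m. h m t)" for t
    unfolding h_def by (rule summable_mult2[OF summable_bernoulli_coeff])
  have fsum: "(\<lambda>m. f m t) sums (of_real t powr (s - 1) * of_real (1 / (exp t - 1) - 1 / t))" if t: "t \<in> {0<..pi}" for t
  proof -
    have "(\<lambda>m. bernoulli_coeff m * t ^ m) sums (1 / (exp t - 1) - 1 / t)"
      using t pi_gt_zero by (intro bernoulli_coeff_sums) auto
    then have "(\<lambda>m. of_real t powr (s - 1) * of_real (bernoulli_coeff m * t ^ m)) sums
           (of_real t powr (s - 1) * of_real (1 / (exp t - 1) - 1 / t))"
      by (intro sums_mult sums_of_real)
    moreover have "of_real t powr (s - 1) * of_real (bernoulli_coeff m * t ^ m) = f m t" for m
    proof -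
      have "complex_of_real t powr (s + of_nat m - 1) = of_real t powr (s - 1) * of_real t powr of_nat m"
        by (simp add: powr_add[symmetric] algebra_simps)
      then show ?thesis
        using t by (simp add: f_def powr_nat')
    qed
    ultimately show ?thesis
      by simp
  qed
  have main: "((\<lambda>t. of_real t powr (s - 1) * of_real (1 / (exp t - 1) - 1 / t)) has_integral
     (\<Sum>m. of_real (bernoulli_coeff m) * (of_real pi powr (s + of_nat m) / (s + of_nat m)))) {0<..pi}"
    by (rule has_integral_sums(2)[OF f h J le hsum fsum])
  have 1: "of_real (bernoulli_coeff m) * (of_real pi powr (s + of_nat m) / (s + of_nat m)) =
     of_real pi powr s * (mellin_coeff m / (s + of_nat m))" for m
    by (simp add: mellin_coeff_def powr_add powr_nat' field_simps)
  have "s \<in> {s. \<forall>m. mellin_coeff m \<noteq> 0 \<longrightarrow> s \<noteq> - of_nat m}"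
    using s by auto
  then have "summable (\<lambda>m. mellin_coeff m / (s + of_nat m))"
    by (intro summable_norm_cancel[OF holomorphic_on_partial_fraction_series(2)[OF summable_mellin_coeff]])
  then have "((\<lambda>t. of_real t powr (s - 1) * of_real (1 / (exp t - 1) - 1 / t)) has_integral
     of_real pi powr s * (\<Sum>m. mellin_coeff m / (s + of_nat m))) {0<..pi}"
    using main unfolding 1 by (subst (asm) suminf_mult)
  moreover have "((\<lambda>t. of_real t powr (s - 1 - 1)) has_integral of_real pi powr (s - 1) / (s - 1)) {0<..pi}"
    using s by (intro has_integral_powr_complex) auto
  ultimately have "((\<lambda>t. of_real t powr (s - 1 - 1) + of_real t powr (s - 1) * of_real (1 / (exp t - 1) - 1 / t)) has_integral
     (of_real pi powr (s - 1) / (s - 1) + of_real pi powr s * (\<Sum>m. mellin_coeff m / (s + of_nat m)))) {0<..pi}"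
    by (intro has_integral_add)
  then show ?thesis
  proof (rule has_integral_eq[rotated])
    fix t assume "t \<in> {0<..pi}"
    then have t: "t > 0"
      by simp
    then have "complex_of_real t powr (s - 1 - 1) = of_real t powr (s - 1) * of_real (1 / t)"
      by (subst powr_diff) (simp add: divide_inverse)
    then show "of_real t powr (s - 1 - 1) + of_real t powr (s - 1) * of_real (1 / (exp t - 1) - 1 / t) =
      of_real t powr (s - 1) / of_real (exp t - 1)"
      by (simp add: algebra_simps)
  qed
qed

lemma is_zeta_continuation_zeta_cont: "is_zeta_continuation zeta_cont"
  unfolding is_zeta_continuation_def
proof (intro conjI allI impI)
  show "zeta_cont holomorphic_on - {1}"
    by (rule zeta_cont_holomorphic)
  fix s :: complex assume s: "Re s > 1"
  let ?f = "\<lambda>t. of_real t powr (s - 1) / of_real (exp t - 1)"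
  have "(?f has_integral zeta_tail s) {pi..}"
    unfolding zeta_tail_def
    by (intro integrable_integral set_lebesgue_integral_eq_integral(1) zeta_tail_integrable)
  then have "(?f has_integral (of_real pi powr (s - 1) / (s - 1) +
             of_real pi powr s * (\<Sum>m. mellin_coeff m / (s + of_nat m)) + zeta_tail s)) ({0<..pi} \<union> {pi..})"
    by (intro has_integral_Un Gamma_zeta_integral_near_0[OF s]) (auto intro: negligible_subset[of "{pi}"])
  also have "{0<..pi} \<union> {pi..} = {0<..}"
    using pi_gt_zero by (auto simp del: pi_gt_zero)
  finally have *: "Gamma s * (\<Sum>n. 1 / of_nat (Suc n) powr s) = zeta_mellin mellin_coeff s"
    using has_integral_unique[OF Gamma_zeta_integral(2)[OF s]] by (simp add: zeta_mellin_def)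
  moreover have ns: "s \<notin> \<int>\<^sub>\<le>\<^sub>0"
    using s by (auto elim!: nonpos_Ints_cases)
  moreover have "rGamma s * Gamma s = 1"
    using ns by (simp add: Gamma_def rGamma_eq_zero_iff)
  ultimately have "zeta_cont s = (\<Sum>n. 1 / of_nat (Suc n) powr s)"
    by (simp add: zeta_cont_def mult.assoc[symmetric] flip: *)
  then show "(\<lambda>n. 1 / of_nat (Suc n) powr s) sums zeta_cont s"
    using Gamma_zeta_integral(1)[OF s] by (simp add: sums_iff)
qed

text \<open>\<open>zeta\<close> is a Hilbert choice: \<open>zeta_cont\<close> shows that there is a
  continuation, and uniqueness away from 1 pins the choice down.\<close>

lemma zeta_eq_zeta_cont: "s \<noteq> 1 \<Longrightarrow> zeta s = zeta_cont s"
  by (metis is_zeta_continuation_unique is_zeta_continuation_zeta_cont someI zeta_def)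

lemma zeta_sums: "Re s > 1 \<Longrightarrow> (\<lambda>n. 1 / of_nat (Suc n) powr s) sums zeta s"
proof -
  assume s: "Re s > 1"
  then have "s \<noteq> 1"
    by auto
  then show ?thesis
    unfolding zeta_eq_zeta_cont[OF \<open>s \<noteq> 1\<close>]
    using is_zeta_continuation_zeta_cont s unfolding is_zeta_continuation_def by blast
qed

text \<open>The origin of Euler's constant and the harmonic numbers in \<open>deriv zeta\<close>.
  The cofactor of index \<open>Suc k\<close> at \<open>s\<close> is \<open>s\<close> times the
  cofactor of index \<open>k\<close> at \<open>s + 1\<close>; the product rule then subtracts
  \<open>1 / (k + 1)\<close> from the logarithmic derivative, which starts at
  \<open>- Digamma 1\<close>.\<close>

lemma has_field_derivative_rGamma_cofactor:
  "(rGamma_cofactor k has_field_derivative (-1) ^ k * fact k * of_real (euler_mascheroni - harm k)) (at (- of_nat k))"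
proof (induction k)
  case 0
  have "(rGamma has_field_derivative - rGamma 1 * Digamma 1) (at (1 :: complex))"
    by (rule has_field_derivative_rGamma_no_nonpos_int) auto
  then have "((\<lambda>s. rGamma (s + 1)) has_field_derivative - rGamma 1 * Digamma 1) (at (0 :: complex))"
    by (intro DERIV_shift[THEN iffD1]) simp
  then show ?case
    by (simp add: rGamma_cofactor_def[abs_def] harm_def)
next
  case (Suc k)
  have eq: "rGamma_cofactor (Suc k) s = s * rGamma_cofactor k (s + 1)" for s
    by (simp add: rGamma_cofactor_def pochhammer_rec add_ac)
  have "((\<lambda>s. rGamma_cofactor k (s + 1)) has_field_derivative
      (-1) ^ k * fact k * of_real (euler_mascheroni - harm k)) (at (- of_nat (Suc k)))"
    using Suc.IH by (intro DERIV_shift[THEN iffD1]) simp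
  then have "((\<lambda>s. s * rGamma_cofactor k (s + 1)) has_field_derivative
      (1 * rGamma_cofactor k (- of_nat (Suc k) + 1) +
        ((-1) ^ k * fact k * of_real (euler_mascheroni - harm k)) * (- of_nat (Suc k)))) (at (- of_nat (Suc k)))"
    by (intro DERIV_mult) auto
  also have "- of_nat (Suc k) + 1 = - (of_nat k :: complex)"
    by simp
  also have "1 * rGamma_cofactor k (- of_nat k) +
        ((-1) ^ k * fact k * of_real (euler_mascheroni - harm k)) * (- of_nat (Suc k)) =
      (-1) ^ Suc k * fact (Suc k) * of_real (euler_mascheroni - harm (Suc k))"
    by (simp add: rGamma_cofactor_at harm_Suc field_simps del: of_nat_Suc)
  also have "(\<lambda>s. s * rGamma_cofactor k (s + 1)) = rGamma_cofactor (Suc k)"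
    by (simp add: eq fun_eq_iff)
  finally show ?case .
qed

section \<open>The derivative of zeta at the nonpositive integers\<close>

text \<open>The product bound makes the family absolutely summable over pairs; the iterated series
  are translated to \<open>infsum\<close> for the exchange and back.\<close>

lemma sums_swap_product_bound:
  fixes u :: "nat \<Rightarrow> nat \<Rightarrow> real"
  assumes le: "\<And>k m. \<bar>u k m\<bar> \<le> A k * B m" and A: "summable A" and B: "summable B"
  shows "(\<lambda>k. \<Sum>m. u k m) sums (\<Sum>m. \<Sum>k. u k m)"
proof -
  have u1: "summable (\<lambda>m. norm (u k m))" for k
    by (rule summable_comparison_test'[OF summable_mult[OF B, of "A k"]]) (use le in auto)
  have u2: "summable (\<lambda>k. norm (u k m))" for m
    by (rule summable_comparison_test'[OF summable_mult2[OF A, of "B m"]]) (use le in auto)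
  have o1: "summable (\<lambda>k. norm (\<Sum>m. u k m))"
  proof (rule summable_comparison_test'[OF summable_mult2[OF A, of "suminf B"]])
    fix k
    have "norm (\<Sum>m. u k m) \<le> (\<Sum>m. norm (u k m))"
      by (rule summable_norm[OF u1])
    also have "\<dots> \<le> (\<Sum>m. A k * B m)"
      by (rule suminf_le[OF _ u1 summable_mult[OF B]]) (use le in auto)
    finally show "norm (norm (\<Sum>m. u k m)) \<le> A k * suminf B"
      by (simp add: suminf_mult[OF B])
  qed
  have o2: "summable (\<lambda>m. norm (\<Sum>k. u k m))"
  proof (rule summable_comparison_test'[OF summable_mult[OF B, of "suminf A"]])
    fix m
    have "norm (\<Sum>k. u k m) \<le> (\<Sum>k. norm (u k m))"
      by (rule summable_norm[OF u2])
    also have "\<dots> \<le> (\<Sum>k. A k * B m)"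
      by (rule suminf_le[OF _ u2 summable_mult2[OF A]]) (use le in auto)
    finally show "norm (norm (\<Sum>k. u k m)) \<le> suminf A * B m"
      by (simp add: suminf_mult2[OF A])
  qed
  have inf: "infsum f UNIV = suminf f" if "summable (\<lambda>n. norm (f n))" for f :: "nat \<Rightarrow> real"
    by (rule infsumI[OF norm_summable_imp_has_sum[OF that summable_sums[OF summable_norm_cancel[OF that]]]])
  have "(\<lambda>(k, m). u k m) summable_on (UNIV \<times> UNIV)"
  proof -
    have "(\<lambda>p. norm (case p of (k, m) \<Rightarrow> u k m)) summable_on (SIGMA k:UNIV. UNIV)"
    proof (rule summable_on_SigmaI)
      show "((\<lambda>m. norm (case (k, m) of (k, m) \<Rightarrow> u k m)) has_sum (\<Sum>m. norm (u k m))) UNIV" for k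
        using sums_nonneg_imp_has_sum[OF summable_sums[OF u1[of k]]] by simp
      have "summable (\<lambda>k. norm (\<Sum>m. norm (u k m)))"
      proof (rule summable_comparison_test'[OF summable_mult2[OF A, of "suminf B"]])
        fix k
        have "(\<Sum>m. norm (u k m)) \<le> (\<Sum>m. A k * B m)"
          by (rule suminf_le[OF _ u1 summable_mult[OF B]]) (use le in auto)
        moreover have "(\<Sum>m. norm (u k m)) \<ge> 0"
          by (rule suminf_nonneg[OF u1]) simp
        ultimately show "norm (norm (\<Sum>m. norm (u k m))) \<le> A k * suminf B"
          by (simp add: suminf_mult[OF B])
      qed
      then show "(\<lambda>k. \<Sum>m. norm (u k m)) summable_on UNIV"
        by (rule norm_summable_imp_summable_on)
    qed auto
    then show ?thesis
      by (rule abs_summable_summable)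
  qed
  then have "(\<Sum>\<^sub>\<infinity>k. \<Sum>\<^sub>\<infinity>m. u k m) = (\<Sum>\<^sub>\<infinity>m. \<Sum>\<^sub>\<infinity>k. u k m)"
    by (rule infsum_swap_banach)
  then have "(\<Sum>k. \<Sum>m. u k m) = (\<Sum>m. \<Sum>k. u k m)"
    by (simp only: inf[OF u1] inf[OF u2] inf[OF o1] inf[OF o2])
  then show ?thesis
    using summable_norm_cancel[OF o1] by (simp add: sums_iff)
qed

lemma zeta_deriv_tail_integrable: "(\<lambda>t. 1 / (t ^ k * (exp t - 1))) integrable_on {pi..}"
proof -
  have exp: "(\<lambda>t. 2 * exp (- t)) integrable_on {pi..}"
    using integrable_on_exp_minus_to_infinity[of 1 pi] by (intro integrable_on_mult_right) simp
  have pos: "t > 0" if "t \<ge> pi" for t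
    using that pi_gt_zero by linarith
  have "continuous_on {pi..} (\<lambda>t::real. 1 / (t ^ k * (exp t - 1)))"
    using pos by (intro continuous_intros) force
  then have "(\<lambda>t. 1 / (t ^ k * (exp t - 1))) absolutely_integrable_on {pi..}"
  proof (intro measurable_bounded_by_integrable_imp_absolutely_integrable[OF _ _ exp]
      continuous_imp_measurable_on_sets_lebesgue)
    fix t :: real assume t: "t \<in> {pi..}"
    then have "t \<ge> 1" "t > 0" "exp t / 2 \<le> exp t - 1"
      using two_le_exp[of t] pi_gt3 by auto
    then have "1 * (exp t / 2) \<le> t ^ k * (exp t - 1)"
      by (intro mult_mono one_le_power) auto
    then have "1 / (t ^ k * (exp t - 1)) \<le> 1 / (exp t / 2)"
      using \<open>t > 0\<close> by (intro divide_left_mono mult_pos_pos zero_less_power) auto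
    also have "1 / (exp t / 2) = 2 * exp (- t)"
      by (simp add: exp_minus inverse_eq_divide)
    also have "1 / (t ^ k * (exp t - 1)) = norm (1 / (t ^ k * (exp t - 1)))"
      using \<open>t > 0\<close> by simp
    finally show "norm (1 / (t ^ k * (exp t - 1))) \<le> 2 * exp (- t)" .
  qed auto
  then show ?thesis
    by (rule set_lebesgue_integral_eq_integral)
qed

text \<open>\<open>deriv zeta (- of_nat k)\<close> with \<open>(-1) ^ k * fact k\<close> divided
  out. The first summand is the derivative of the term whose pole was cancelled, with
  \<open>ln pi\<close> coming from \<open>pi powr s\<close>; the other three are the values at
  \<open>- of_nat k\<close> of the remaining parts of \<open>zeta_mellin\<close>.\<close>

definition zeta_deriv_coeff :: "nat \<Rightarrow> real" where
  "zeta_deriv_coeff k = bernoulli_coeff k * (euler_mascheroni + ln pi - harm k)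
     - 1 / (real (Suc k) * pi ^ Suc k)
     + (\<Sum>m. if m = k then 0 else bernoulli_coeff m * pi ^ m / (pi ^ k * (real m - real k)))
     + integral {pi..} (\<lambda>t. 1 / (t ^ Suc k * (exp t - 1)))"

text \<open>\<open>rGamma\<close> vanishes at \<open>- of_nat k\<close> with derivative
  \<open>(-1) ^ k * fact k\<close>. By the product rule the regular part of
  \<open>zeta_mellin\<close> thus enters through its value only, and its derivative
  \<open>Z'\<close> drops out.\<close>

lemma deriv_zeta_neg_nat:
  "deriv zeta (- of_nat k) = of_real ((-1) ^ k * fact k * zeta_deriv_coeff k)"
proof -
  let ?d = "mellin_coeff(k := 0)" and ?s = "- of_nat k :: complex"
  let ?f = "\<lambda>s. rGamma_cofactor k s * of_real pi powr s * mellin_coeff k + rGamma s * zeta_mellin ?d s"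
  have pik: "complex_of_real pi powr ?s = 1 / of_real pi ^ k"
    by (simp add: powr_minus powr_nat' divide_inverse)
  have d: "summable (\<lambda>m. norm (?d m))"
    by (rule summable_comparison_test'[OF summable_mellin_coeff]) auto
  have "?s \<noteq> 1"
  proof
    assume "?s = 1"
    then have "Re ?s = Re 1"
      by (rule arg_cong)
    then show False
      by simp
  qed
  then have sS: "?s \<in> {s. \<forall>m. ?d m \<noteq> 0 \<longrightarrow> s \<noteq> - of_nat m} - {1}"
    by auto
  have "open ({s :: complex. \<forall>m. ?d m \<noteq> 0 \<longrightarrow> s \<noteq> - of_nat m} - {1})"
    using holomorphic_on_partial_fraction_series(3)[OF d] by (rule open_Diff) (rule closed_singleton)
  from holomorphic_on_open[OF this, THEN iffD1, OF zeta_mellin_holomorphic[OF d]] sS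
  obtain Z' where Z': "(zeta_mellin ?d has_field_derivative Z') (at ?s)"
    by blast
  have powr': "((\<lambda>s. complex_of_real pi powr s) has_field_derivative of_real (ln pi) * of_real pi powr ?s) (at ?s)"
    by (auto intro!: derivative_eq_intros simp: Ln_of_real)
  have "(?f has_field_derivative
      ((-1) ^ k * fact k * of_real (euler_mascheroni - harm k) * of_real pi powr ?s +
        of_real (ln pi) * of_real pi powr ?s * rGamma_cofactor k ?s) * mellin_coeff k +
      ((-1) ^ k * fact k * zeta_mellin ?d ?s + Z' * rGamma ?s)) (at ?s)"
    by (intro DERIV_add DERIV_cmult_right DERIV_mult has_field_derivative_rGamma_cofactor powr' Z'
        has_field_derivative_rGamma_nonpos_int)
  moreover have "\<forall>\<^sub>F s in nhds ?s. zeta s = ?f s"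
  proof -
    have "\<forall>\<^sub>F s in nhds ?s. s \<in> ball ?s 1 - {1}"
      using \<open>?s \<noteq> 1\<close> by (intro eventually_nhds_in_open open_Diff) auto
    then show ?thesis
      by eventually_elim (use zeta_cont_near[of _ k] in \<open>auto simp: zeta_eq_zeta_cont\<close>)
  qed
  ultimately have "deriv zeta ?s =
      ((-1) ^ k * fact k * of_real (euler_mascheroni - harm k) * of_real pi powr ?s +
        of_real (ln pi) * of_real pi powr ?s * rGamma_cofactor k ?s) * mellin_coeff k +
      ((-1) ^ k * fact k * zeta_mellin ?d ?s + Z' * rGamma ?s)"
    by (subst deriv_cong_ev[of zeta ?f]) (auto intro: DERIV_imp_deriv)
  also have "\<dots> = (-1) ^ k * fact k * (of_real (bernoulli_coeff k * (euler_mascheroni + ln pi - harm k)) + zeta_mellin ?d ?s)"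
    by (simp add: pik rGamma_cofactor_at mellin_coeff_def field_simps)
  also have "zeta_mellin ?d ?s = of_real (- 1 / (real (Suc k) * pi ^ Suc k)
     + (\<Sum>m. if m = k then 0 else bernoulli_coeff m * pi ^ m / (pi ^ k * (real m - real k)))
     + integral {pi..} (\<lambda>t. 1 / (t ^ Suc k * (exp t - 1))))"
  proof -
    have 0: "complex_of_real t powr (?s - 1) = of_real (1 / t ^ Suc k)" if "t > 0" for t
    proof -
      have "?s - 1 = - of_nat (Suc k)"
        by simp
      then show ?thesis
        using that powr_nat'[of "of_real t" "Suc k"] by (simp only: powr_minus) (simp add: divide_inverse)
    qed
    have 1: "of_real pi powr (?s - 1) / (?s - 1) = of_real (- 1 / (real (Suc k) * pi ^ Suc k))"
    proof -
      have "?s - 1 = - of_nat (Suc k)"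
        by simp
      then show ?thesis
        unfolding 0[OF pi_gt_zero] by (simp only: divide_minus_right) (simp add: mult.commute)
    qed
    have 2: "of_real pi powr ?s * (\<Sum>m. ?d m / (?s + of_nat m)) =
      of_real (\<Sum>m. if m = k then 0 else bernoulli_coeff m * pi ^ m / (pi ^ k * (real m - real k)))"
    proof -
      have s: "summable (\<lambda>m. ?d m / (?s + of_nat m))"
        by (intro summable_norm_cancel[OF holomorphic_on_partial_fraction_series(2)[OF d]]) auto
      have eq: "of_real pi powr ?s * (?d m / (?s + of_nat m)) = of_real (if m = k then 0 else bernoulli_coeff m * pi ^ m / (pi ^ k * (real m - real k)))" for m
        by (simp add: pik mellin_coeff_def)
      have "summable (\<lambda>m. of_real pi powr ?s * (?d m / (?s + of_nat m)))"
        using s by (rule summable_mult)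
      then have "summable (\<lambda>m. if m = k then 0 else bernoulli_coeff m * pi ^ m / (pi ^ k * (real m - real k)))"
        unfolding eq by (simp only: summable_of_real_iff)
      then show ?thesis
        unfolding suminf_mult[OF s, symmetric] eq by (rule suminf_of_real[symmetric])
    qed
    have 3: "zeta_tail ?s = of_real (integral {pi..} (\<lambda>t. 1 / (t ^ Suc k * (exp t - 1))))"
    proof -
      have "zeta_tail ?s = integral {pi..} (\<lambda>t. of_real (1 / (t ^ Suc k * (exp t - 1))))"
        unfolding zeta_tail_def
      proof (rule integral_cong)
        fix t assume "t \<in> {pi..}"
        then have "t > 0"
          using pi_gt_zero by (simp del: pi_gt_zero)
        from 0[OF this] show "complex_of_real t powr (?s - 1) / of_real (exp t - 1) = of_real (1 / (t ^ Suc k * (exp t - 1)))"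
          by simp
      qed
      also have "\<dots> = of_real (integral {pi..} (\<lambda>t. 1 / (t ^ Suc k * (exp t - 1))))"
        by (intro integral_unique has_integral_of_real integrable_integral zeta_deriv_tail_integrable)
      finally show ?thesis .
    qed
    show ?thesis
      unfolding zeta_mellin_def 1 2 3 by simp
  qed
  finally show ?thesis
    by (simp add: zeta_deriv_coeff_def algebra_simps)
qed

section \<open>Summation of the derivatives against powers of \<open>- z\<close>\<close>

lemma ln_one_plus_sums:
  assumes "\<bar>x :: real\<bar> < 1"
  shows "(\<lambda>k. (- x) ^ k / real (Suc k) * x) sums ln (1 + x)"
proof -
  have "(\<lambda>n. - ((- x) ^ n) / real n) sums ln (1 + x)"
    using assms by (rule ln_series')
  then have "(\<lambda>n. - ((- x) ^ Suc n) / real (Suc n)) sums ln (1 + x)"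
    by (subst sums_Suc_iff) simp
  then show ?thesis
    by (simp add: mult.commute)
qed

lemma harm_le: "harm k \<le> real k"
proof (induction k)
  case (Suc k)
  have "inverse (real (Suc k)) \<le> 1"
    by (simp add: inverse_eq_divide)
  with Suc show ?case
    unfolding harm_Suc by (simp add: add_mono del: of_nat_Suc)
qed (simp add: harm_def)

text \<open>The trivial powers match the case \<open>m = 0\<close> of
  \<open>has_integral_power_over_linear\<close>. The value is \<open>ln (pi + z) - ln z\<close>,
  with the part expandable in powers of \<open>z\<close> separated from the logarithm of
  \<open>z\<close>.\<close>

lemma has_integral_inverse_linear:
  fixes z :: real
  assumes z: "z > 0"
  shows "((\<lambda>t. t ^ 0 / (t + z)) has_integral (ln (1 + z / pi) + (- z) ^ 0 * (ln pi - ln z))) {0..pi}"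
proof -
  have "((\<lambda>t. 1 / (t + z)) has_integral (ln (pi + z) - ln (0 + z))) {0..pi}"
    using z by (intro fundamental_theorem_of_calculus)
      (auto intro!: derivative_eq_intros simp: divide_inverse simp flip: has_real_derivative_iff_has_vector_derivative)
  moreover have "ln (1 + z / pi) + (- z) ^ 0 * (ln pi - ln z) = ln (pi + z) - ln (0 + z)"
  proof -
    have "1 + z / pi = (pi + z) / pi"
      by (simp add: field_simps)
    then show ?thesis
      using z add_pos_pos[OF pi_gt_zero z] by (simp add: ln_div)
  qed
  ultimately show ?thesis
    by (simp only: power_0)
qed

text \<open>The off-diagonal double series of \<open>zeta_deriv_coeff\<close>, summed over \<open>k\<close> first.\<close>

lemma has_integral_power_over_linear:
  fixes z :: real
  assumes z: "0 < z" "z < pi"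
  shows "((\<lambda>t. t ^ m / (t + z)) has_integral
           ((\<Sum>k. if m = k then 0 else (- z) ^ k * (pi ^ m / (pi ^ k * (real m - real k))))
             + (- z) ^ m * (ln pi - ln z))) {0..pi}"
    and "summable (\<lambda>k. if m = k then 0 else (- z) ^ k * (pi ^ m / (pi ^ k * (real m - real k))))"
proof (induction m)
  case 0
  have "(\<lambda>k. (- (z / pi)) ^ k / real (Suc k) * (z / pi)) sums ln (1 + z / pi)"
    using z by (intro ln_one_plus_sums) simp
  moreover have "(- (z / pi)) ^ k / real (Suc k) * (z / pi) =
      (if 0 = Suc k then 0 else (- z) ^ Suc k * (pi ^ 0 / (pi ^ Suc k * (real 0 - real (Suc k)))))" for k
  proof -
    have "real 0 - real (Suc k) = - real (Suc k)"
      by simp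
    then show ?thesis
      by (simp add: power_minus[of z] power_minus[of "z / pi"] power_divide mult.commute del: of_nat_Suc)
  qed
  ultimately have "(\<lambda>k. if 0 = Suc k then 0 else (- z) ^ Suc k * (pi ^ 0 / (pi ^ Suc k * (real 0 - real (Suc k)))))
      sums ln (1 + z / pi)"
    by simp
  then have *: "(\<lambda>k. if 0 = k then 0 else (- z) ^ k * (pi ^ 0 / (pi ^ k * (real 0 - real k)))) sums ln (1 + z / pi)"
    by (subst (asm) sums_Suc_iff) simp
  case 2
  show ?case
    using * by (rule sums_summable)
  case 1
  show ?case
    unfolding sums_unique[OF *, symmetric] using z(1) by (rule has_integral_inverse_linear)
next
  case (Suc m)
  let ?u = "\<lambda>m k. if m = k then 0 else (- z) ^ k * (pi ^ m / (pi ^ k * (real m - real k)))"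
  \<comment> \<open>Series and integral obey the same recursion:
    \<open>t ^ Suc m / (t + z) = t ^ m - z * (t ^ m / (t + z))\<close>, and the new term with index
    0, \<open>pi ^ Suc m / Suc m\<close>, is the integral of \<open>t ^ m\<close>.\<close>
  have eq: "?u (Suc m) (Suc k) = (- z) * ?u m k" for k
    by simp
  have "(\<lambda>k. ?u (Suc m) (Suc k)) sums ((- z) * suminf (?u m))"
    unfolding eq by (intro sums_mult summable_sums Suc.IH)
  then have *: "?u (Suc m) sums ((- z) * suminf (?u m) + ?u (Suc m) 0)"
    by (subst (asm) sums_Suc_iff) (simp add: algebra_simps)
  case 2
  show ?case
    using * by (rule sums_summable)
  case 1
  have pow: "((\<lambda>t. t ^ m) has_integral (pi ^ Suc m / real (Suc m) - 0 ^ Suc m / real (Suc m))) {0..pi}"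
    by (intro fundamental_theorem_of_calculus)
      (auto intro!: derivative_eq_intros simp del: power_Suc of_nat_Suc
        simp flip: has_real_derivative_iff_has_vector_derivative)
  have "((\<lambda>t. t ^ m - z * (t ^ m / (t + z))) has_integral
     (pi ^ Suc m / real (Suc m) - 0 ^ Suc m / real (Suc m) - z * (suminf (?u m) + (- z) ^ m * (ln pi - ln z)))) {0..pi}"
    by (intro has_integral_diff pow has_integral_mult_right Suc.IH)
  moreover have "t ^ m - z * (t ^ m / (t + z)) = t ^ Suc m / (t + z)" if "t \<in> {0..pi}" for t
    using that z by (simp add: field_simps)
  ultimately have "((\<lambda>t. t ^ Suc m / (t + z)) has_integral
     (pi ^ Suc m / real (Suc m) - 0 ^ Suc m / real (Suc m) - z * (suminf (?u m) + (- z) ^ m * (ln pi - ln z)))) {0..pi}"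
    by (rule has_integral_eq[rotated])
  moreover have "pi ^ Suc m / real (Suc m) - 0 ^ Suc m / real (Suc m) - z * (suminf (?u m) + (- z) ^ m * (ln pi - ln z)) =
     suminf (?u (Suc m)) + (- z) ^ Suc m * (ln pi - ln z)"
    unfolding sums_unique[OF *, symmetric] by (simp add: algebra_simps)
  ultimately show ?case
    by simp
qed

context
  fixes z :: real
  assumes z: "0 < z" "z < pi"
begin

lemma geometric_ratio_summable: "summable (\<lambda>k. (z / pi) ^ k)"
  using z by (intro summable_geometric) simp

lemma bernoulli_coeff_power_sums:
  "(\<lambda>m. bernoulli_coeff m * (- z) ^ m) sums (1 / (exp (- z) - 1) - 1 / (- z))"
  using z by (intro bernoulli_coeff_sums) auto

lemma bernoulli_coeff_integral:
  "((\<lambda>t. (1 / (exp t - 1) - 1 / t) / (t + z)) has_integral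
     (\<Sum>m. bernoulli_coeff m * integral {0<..pi} (\<lambda>t. t ^ m / (t + z)))) {0<..pi}"
    (is ?A)
  and bernoulli_coeff_integral_summable:
    "summable (\<lambda>m. bernoulli_coeff m * integral {0<..pi} (\<lambda>t. t ^ m / (t + z)))" (is ?B)
proof -
  have ii: "(\<lambda>t. t ^ m / (t + z)) integrable_on {0<..pi}" for m
    using has_integral_power_over_linear(1)[OF z, of m]
    by (subst integrable_spike_set_eq[of "{0<..pi}" "{0..pi}"]) (auto intro: negligible_subset[of "{0}"])
  have 0: "(\<lambda>t. 1 / (t + z)) integrable_on {0<..pi}"
    using ii[of 0] by simp
  have f: "((\<lambda>t. bernoulli_coeff m * (t ^ m / (t + z))) has_integral
     bernoulli_coeff m * integral {0<..pi} (\<lambda>t. t ^ m / (t + z))) {0<..pi}" for m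
    by (intro has_integral_mult_right integrable_integral ii)
  have h: "((\<lambda>t. \<bar>bernoulli_coeff m\<bar> * pi ^ m * (1 / (t + z))) has_integral
     \<bar>bernoulli_coeff m\<bar> * pi ^ m * integral {0<..pi} (\<lambda>t. 1 / (t + z))) {0<..pi}" for m
    by (intro has_integral_mult_right integrable_integral 0)
  have J: "summable (\<lambda>m. \<bar>bernoulli_coeff m\<bar> * pi ^ m * integral {0<..pi} (\<lambda>t. 1 / (t + z)))"
    by (rule summable_mult2[OF summable_bernoulli_coeff])
  have hsum: "summable (\<lambda>m. \<bar>bernoulli_coeff m\<bar> * pi ^ m * (1 / (t + z)))" for t
    by (rule summable_mult2[OF summable_bernoulli_coeff])
  have le: "norm (bernoulli_coeff m * (t ^ m / (t + z))) \<le> \<bar>bernoulli_coeff m\<bar> * pi ^ m * (1 / (t + z))"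
    if t: "t \<in> {0<..pi}" for m t
  proof -
    have "\<bar>bernoulli_coeff m\<bar> * t ^ m * (1 / (t + z)) \<le> \<bar>bernoulli_coeff m\<bar> * pi ^ m * (1 / (t + z))"
      using t z by (intro mult_right_mono mult_left_mono power_mono) auto
    then show ?thesis
      using t z by (simp add: abs_mult)
  qed
  have g: "(\<lambda>m. bernoulli_coeff m * (t ^ m / (t + z))) sums ((1 / (exp t - 1) - 1 / t) / (t + z))"
    if t: "t \<in> {0<..pi}" for t
  proof -
    have "(\<lambda>m. bernoulli_coeff m * t ^ m) sums (1 / (exp t - 1) - 1 / t)"
      using t pi_gt_zero by (intro bernoulli_coeff_sums) auto
    then have "(\<lambda>m. bernoulli_coeff m * t ^ m / (t + z)) sums ((1 / (exp t - 1) - 1 / t) / (t + z))"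
      by (rule sums_divide)
    then show ?thesis
      by simp
  qed
  show ?A
    by (rule has_integral_sums(2)[OF f h J le hsum g])
  have "summable (\<lambda>m. norm (bernoulli_coeff m * integral {0<..pi} (\<lambda>t. t ^ m / (t + z))))"
    by (rule has_integral_sums(1)[OF f h J le hsum g])
  then show ?B
    by (rule summable_norm_cancel)
qed

text \<open>Summed over \<open>k\<close> first, the terms with fixed \<open>m\<close> give the
  integral of \<open>t ^ m / (t + z)\<close>, except that the missing diagonal index costs a
  logarithm. The sum over \<open>m\<close> then reassembles \<open>1 / (exp t - 1) - 1 / t\<close>
  under the integral and, in the logarithmic part, the same function at \<open>- z\<close>.\<close>

lemma bernoulli_double_series_sums:
  "(\<lambda>k. (- z) ^ k * (\<Sum>m. if m = k then 0 else bernoulli_coeff m * pi ^ m / (pi ^ k * (real m - real k)))) sums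
     (integral {0<..pi} (\<lambda>t. (1 / (exp t - 1) - 1 / t) / (t + z))
       - (1 / (exp (- z) - 1) - 1 / (- z)) * (ln pi - ln z))"
proof -
  define u where "u k m = (if m = k then 0 else (- z) ^ k * (bernoulli_coeff m * pi ^ m / (pi ^ k * (real m - real k))))" for k m
  \<comment> \<open>Off the diagonal \<open>m - k\<close> has modulus at least 1, so dropping it
    leaves a product of two summable sequences.\<close>
  have le: "\<bar>u k m\<bar> \<le> (z / pi) ^ k * (\<bar>bernoulli_coeff m\<bar> * pi ^ m)" for k m
  proof (cases "m = k")
    case False
    then have "\<bar>real m - real k\<bar> \<ge> 1"
      by linarith
    then have "z ^ k * (\<bar>bernoulli_coeff m\<bar> * pi ^ m) / (pi ^ k * \<bar>real m - real k\<bar>) \<le>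
        z ^ k * (\<bar>bernoulli_coeff m\<bar> * pi ^ m) / (pi ^ k * 1)"
      using z by (intro divide_left_mono mult_left_mono mult_pos_pos) auto
    then show ?thesis
      using False z by (simp add: u_def abs_mult power_abs power_divide)
  qed (use z in \<open>simp add: u_def\<close>)
  have usum: "summable (u k)" for k
    by (rule summable_norm_cancel, rule summable_comparison_test'[OF summable_mult[OF summable_bernoulli_coeff]])
       (use le in auto)
  have S: "(\<Sum>k. u k m) = bernoulli_coeff m * integral {0<..pi} (\<lambda>t. t ^ m / (t + z))
      - bernoulli_coeff m * (- z) ^ m * (ln pi - ln z)" for m
  proof -
    let ?S = "\<Sum>k. if m = k then 0 else (- z) ^ k * (pi ^ m / (pi ^ k * (real m - real k)))"
    have "integral {0<..pi} (\<lambda>t. t ^ m / (t + z)) = integral {0..pi} (\<lambda>t. t ^ m / (t + z))"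
      by (rule integral_spike_set) (auto intro: negligible_subset[of "{0}"])
    also have "\<dots> = ?S + (- z) ^ m * (ln pi - ln z)"
      using has_integral_power_over_linear(1)[OF z] by (rule integral_unique)
    finally have 1: "integral {0<..pi} (\<lambda>t. t ^ m / (t + z)) = ?S + (- z) ^ m * (ln pi - ln z)" .
    have 2: "(\<Sum>k. u k m) = bernoulli_coeff m * ?S"
      unfolding suminf_mult[OF has_integral_power_over_linear(2)[OF z], symmetric]
      by (intro suminf_cong) (auto simp: u_def)
    show ?thesis
      unfolding 1 2 by (simp add: algebra_simps)
  qed
  have "(\<lambda>k. \<Sum>m. u k m) sums (\<Sum>m. \<Sum>k. u k m)"
    by (rule sums_swap_product_bound[OF le geometric_ratio_summable summable_bernoulli_coeff])
  moreover have "(\<Sum>m. u k m) = (- z) ^ k * (\<Sum>m. if m = k then 0 else bernoulli_coeff m * pi ^ m / (pi ^ k * (real m - real k)))" for k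
  proof -
    let ?v = "\<lambda>m. if m = k then 0 else bernoulli_coeff m * pi ^ m / (pi ^ k * (real m - real k))"
    have eq: "u k m = (- z) ^ k * ?v m" for m
      by (simp add: u_def)
    then have uk: "u k = (\<lambda>m. (- z) ^ k * ?v m)"
      by (rule ext)
    have "summable (\<lambda>m. (- z) ^ k * ?v m)"
      using usum[of k] unfolding uk .
    then have "summable ?v"
      by (rule summable_mult_D) (use z in simp)
    then show ?thesis
      unfolding eq by (rule suminf_mult)
  qed
  moreover have "(\<Sum>m. \<Sum>k. u k m) = integral {0<..pi} (\<lambda>t. (1 / (exp t - 1) - 1 / t) / (t + z))
       - (1 / (exp (- z) - 1) - 1 / (- z)) * (ln pi - ln z)"
    unfolding S integral_unique[OF bernoulli_coeff_integral]
    by (intro sums_unique[symmetric] sums_diff summable_sums bernoulli_coeff_integral_summable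
        sums_mult2 bernoulli_coeff_power_sums)
  ultimately show ?thesis
    by simp
qed

text \<open>Here \<open>t \<ge> pi > z\<close>, so the powers of \<open>- z / t\<close> form a
  geometric series; the ratio \<open>z / pi\<close> bounds it uniformly in \<open>t\<close>.\<close>

lemma zeta_tail_series_sums:
  "(\<lambda>k. (- z) ^ k * integral {pi..} (\<lambda>t. 1 / (t ^ Suc k * (exp t - 1)))) sums
     integral {pi..} (\<lambda>t. 1 / ((exp t - 1) * (t + z)))"
  and zeta_tail_series_integrable: "(\<lambda>t. 1 / ((exp t - 1) * (t + z))) integrable_on {pi..}"
proof -
  have f: "((\<lambda>t. (- z) ^ k * (1 / (t ^ Suc k * (exp t - 1)))) has_integral
      (- z) ^ k * integral {pi..} (\<lambda>t. 1 / (t ^ Suc k * (exp t - 1)))) {pi..}" for k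
    by (intro has_integral_mult_right integrable_integral zeta_deriv_tail_integrable)
  have h: "((\<lambda>t. (z / pi) ^ k * (1 / (t ^ 1 * (exp t - 1)))) has_integral
      (z / pi) ^ k * integral {pi..} (\<lambda>t. 1 / (t ^ 1 * (exp t - 1)))) {pi..}" for k
    by (intro has_integral_mult_right integrable_integral zeta_deriv_tail_integrable)
  have J: "summable (\<lambda>k. (z / pi) ^ k * integral {pi..} (\<lambda>t. 1 / (t ^ 1 * (exp t - 1))))"
    by (rule summable_mult2[OF geometric_ratio_summable])
  have hsum: "summable (\<lambda>k. (z / pi) ^ k * (1 / (t ^ 1 * (exp t - 1))))" for t
    by (rule summable_mult2[OF geometric_ratio_summable])
  have pos: "t > 0" if "t \<ge> pi" for t
    using that pi_gt_zero by linarith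
  have le: "norm ((- z) ^ k * (1 / (t ^ Suc k * (exp t - 1)))) \<le> (z / pi) ^ k * (1 / (t ^ 1 * (exp t - 1)))"
    if t: "t \<in> {pi..}" for k t
  proof -
    have "norm ((- z) ^ k * (1 / (t ^ Suc k * (exp t - 1)))) = (z / t) ^ k * (1 / (t ^ 1 * (exp t - 1)))"
      using t pos[of t] z by (simp add: abs_mult power_abs power_divide)
    also have "\<dots> \<le> (z / pi) ^ k * (1 / (t ^ 1 * (exp t - 1)))"
      using t pos[of t] z by (intro mult_right_mono power_mono divide_left_mono) auto
    finally show ?thesis .
  qed
  have g: "(\<lambda>k. (- z) ^ k * (1 / (t ^ Suc k * (exp t - 1)))) sums (1 / ((exp t - 1) * (t + z)))"
    if t: "t \<in> {pi..}" for t
  proof -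
    have "(\<lambda>k. (- z / t) ^ k * (1 / (t * (exp t - 1)))) sums (1 / (1 - - z / t) * (1 / (t * (exp t - 1))))"
      using t pos[of t] z by (intro sums_mult2 geometric_sums) simp
    also have "(\<lambda>k. (- z / t) ^ k * (1 / (t * (exp t - 1)))) = (\<lambda>k. (- z) ^ k * (1 / (t ^ Suc k * (exp t - 1))))"
      by (simp add: power_minus[of z] power_minus[of "z / t"] power_divide fun_eq_iff mult_ac)
    also have "1 / (1 - - z / t) * (1 / (t * (exp t - 1))) = 1 / ((exp t - 1) * (t + z))"
      using t pos[of t] z by (simp add: divide_simps)
    finally show ?thesis .
  qed
  have *: "((\<lambda>t. 1 / ((exp t - 1) * (t + z))) has_integral
    (\<Sum>k. (- z) ^ k * integral {pi..} (\<lambda>t. 1 / (t ^ Suc k * (exp t - 1))))) {pi..}"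
    by (rule has_integral_sums(2)[OF f h J le hsum g])
  have "summable (\<lambda>k. norm ((- z) ^ k * integral {pi..} (\<lambda>t. 1 / (t ^ Suc k * (exp t - 1)))))"
    by (rule has_integral_sums(1)[OF f h J le hsum g])
  then show "(\<lambda>k. (- z) ^ k * integral {pi..} (\<lambda>t. 1 / (t ^ Suc k * (exp t - 1)))) sums
     integral {pi..} (\<lambda>t. 1 / ((exp t - 1) * (t + z)))"
    unfolding integral_unique[OF *] by (rule summable_sums[OF summable_norm_cancel])
  show "(\<lambda>t. 1 / ((exp t - 1) * (t + z))) integrable_on {pi..}"
    using * by (rule has_integral_integrable)
qed

text \<open>The gap between \<open>z\<close> and \<open>pi\<close> absorbs the harmonic numbers,
  because \<open>real k * (z / pi) ^ k\<close> stays bounded.\<close>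

lemma summable_bernoulli_coeff_harm: "summable (\<lambda>k. bernoulli_coeff k * (harm k * z ^ k))"
proof -
  have "(\<lambda>k. real k * (z / pi) ^ k) \<longlonglongrightarrow> 0"
    using z by (intro powser_times_n_limit_0) simp
  then have "Bseq (\<lambda>k. real k * (z / pi) ^ k)"
    by (intro convergent_imp_Bseq convergentI)
  then obtain K where K: "norm (real k * (z / pi) ^ k) \<le> K" for k
    by (auto simp: Bseq_def)
  show ?thesis
  proof (rule summable_comparison_test'[OF summable_mult2[OF summable_bernoulli_coeff, of K]])
    fix k :: nat
    have "harm k * (z / pi) ^ k \<le> real k * (z / pi) ^ k"
      using z by (intro mult_right_mono harm_le) auto
    also have "\<dots> \<le> K"
      using K[of k] by simp
    finally have "\<bar>bernoulli_coeff k\<bar> * pi ^ k * (harm k * (z / pi) ^ k) \<le> \<bar>bernoulli_coeff k\<bar> * pi ^ k * K"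
      by (intro mult_left_mono) auto
    then show "norm (bernoulli_coeff k * (harm k * z ^ k)) \<le> \<bar>bernoulli_coeff k\<bar> * pi ^ k * K"
      using z harm_nonneg[of k, where ?'a = real] by (simp add: abs_mult power_divide)
  qed
qed

text \<open>\<open>ln (1 + z / pi) / z\<close> is the integral of \<open>1 / (t * (t + z))\<close>
  over \<open>{pi..}\<close>, so the last three terms together are the Stieltjes transform of
  \<open>1 / (exp t - 1) - 1 / t\<close> at \<open>z\<close>.\<close>

lemma zeta_deriv_coeff_sums:
  "(\<lambda>k. (- z) ^ k * zeta_deriv_coeff k) sums
     ((1 / (exp (- z) - 1) - 1 / (- z)) * (euler_mascheroni + ln z)
       + (\<Sum>k. bernoulli_coeff k * (harm k * z ^ k))
       - ln (1 + z / pi) / z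
       + integral {0<..pi} (\<lambda>t. (1 / (exp t - 1) - 1 / t) / (t + z))
       + integral {pi..} (\<lambda>t. 1 / ((exp t - 1) * (t + z))))"
proof -
  let ?T = "1 / (exp (- z) - 1) - 1 / (- z)"
  have "(\<lambda>k. bernoulli_coeff k * (- z) ^ k * (euler_mascheroni + ln pi)) sums (?T * (euler_mascheroni + ln pi))"
    by (intro sums_mult2 bernoulli_coeff_power_sums)
  moreover have "(\<lambda>k. bernoulli_coeff k * (harm k * z ^ k)) sums (\<Sum>k. bernoulli_coeff k * (harm k * z ^ k))"
    by (intro summable_sums summable_bernoulli_coeff_harm)
  moreover have "(\<lambda>k. - ((- (z / pi)) ^ k / real (Suc k) * (z / pi) / z)) sums (- (ln (1 + z / pi) / z))"
    using z by (intro sums_minus sums_divide ln_one_plus_sums) simp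
  moreover note bernoulli_double_series_sums zeta_tail_series_sums
  ultimately have *: "(\<lambda>k. bernoulli_coeff k * (- z) ^ k * (euler_mascheroni + ln pi)
      + bernoulli_coeff k * (harm k * z ^ k)
      + - ((- (z / pi)) ^ k / real (Suc k) * (z / pi) / z)
      + (- z) ^ k * (\<Sum>m. if m = k then 0 else bernoulli_coeff m * pi ^ m / (pi ^ k * (real m - real k)))
      + (- z) ^ k * integral {pi..} (\<lambda>t. 1 / (t ^ Suc k * (exp t - 1)))) sums
    (?T * (euler_mascheroni + ln pi) + (\<Sum>k. bernoulli_coeff k * (harm k * z ^ k)) + (- (ln (1 + z / pi) / z))
      + (integral {0<..pi} (\<lambda>t. (1 / (exp t - 1) - 1 / t) / (t + z)) - ?T * (ln pi - ln z))
      + integral {pi..} (\<lambda>t. 1 / ((exp t - 1) * (t + z))))"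
    by (intro sums_add)
  \<comment> \<open>Reflection of the Bernoulli numbers exchanges \<open>- z\<close> for
    \<open>z\<close> at the price of a sign for \<open>k \<ge> 1\<close>; for \<open>k = 0\<close>
    both sides vanish with \<open>harm 0\<close>.\<close>
  have "bernoulli_coeff k * (harm k * z ^ k) = - (bernoulli_coeff k * (harm k * (- z) ^ k))" for k
  proof (cases "k = 0")
    case False
    have "bernoulli_coeff k * (- z) ^ k = ((- 1) ^ k * bernoulli_coeff k) * z ^ k"
      by (simp add: power_minus[of z])
    also have "\<dots> = - (bernoulli_coeff k * z ^ k)"
      using False by (simp add: bernoulli_coeff_reflect)
    finally have "harm k * (bernoulli_coeff k * (- z) ^ k) = - (harm k * (bernoulli_coeff k * z ^ k))"
      by simp
    then show ?thesis
      by (simp only: mult.left_commute)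
  qed (simp add: harm_def)
  moreover have "- ((- (z / pi)) ^ k / real (Suc k) * (z / pi) / z) = - ((- z) ^ k * (1 / (real (Suc k) * pi ^ Suc k)))" for k
    using z by (simp add: power_minus[of z] power_minus[of "z / pi"] power_divide)
  ultimately have eq: "bernoulli_coeff k * (- z) ^ k * (euler_mascheroni + ln pi)
      + bernoulli_coeff k * (harm k * z ^ k)
      + - ((- (z / pi)) ^ k / real (Suc k) * (z / pi) / z)
      + (- z) ^ k * (\<Sum>m. if m = k then 0 else bernoulli_coeff m * pi ^ m / (pi ^ k * (real m - real k)))
      + (- z) ^ k * integral {pi..} (\<lambda>t. 1 / (t ^ Suc k * (exp t - 1))) = (- z) ^ k * zeta_deriv_coeff k" for k
    unfolding zeta_deriv_coeff_def by (simp only: algebra_simps)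
  \<comment> \<open>\<open>ln pi\<close> cancels between the diagonal terms and the double series,
    and \<open>ln z\<close> remains.\<close>
  have "?T * (euler_mascheroni + ln pi) - ?T * (ln pi - ln z) = ?T * (euler_mascheroni + ln z)"
    by (simp only: right_diff_distrib[symmetric]) simp
  then have V: "?T * (euler_mascheroni + ln pi) + (\<Sum>k. bernoulli_coeff k * (harm k * z ^ k)) + (- (ln (1 + z / pi) / z))
      + (integral {0<..pi} (\<lambda>t. (1 / (exp t - 1) - 1 / t) / (t + z)) - ?T * (ln pi - ln z))
      + integral {pi..} (\<lambda>t. 1 / ((exp t - 1) * (t + z))) =
    ?T * (euler_mascheroni + ln z) + (\<Sum>k. bernoulli_coeff k * (harm k * z ^ k)) - ln (1 + z / pi) / z
       + integral {0<..pi} (\<lambda>t. (1 / (exp t - 1) - 1 / t) / (t + z))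
       + integral {pi..} (\<lambda>t. 1 / ((exp t - 1) * (t + z)))"
    by linarith
  show ?thesis
    using * unfolding eq V .
qed

end

section \<open>The Borel sum\<close>

lemma has_integral_exp_neg_Ioi:
  assumes "a > 0"
  shows "((\<lambda>t::real. exp (- (a * t))) has_integral (1 / a)) {0<..}"
proof -
  have "((\<lambda>t. exp (- a * t)) has_integral (exp (- a * 0) / a)) {0..}"
    by (rule has_integral_exp_minus_to_infinity[OF assms])
  then show ?thesis
    by (subst has_integral_spike_set_eq[of "{0<..}" "{0..}"]) (auto intro: negligible_subset[of "{0}"])
qed

text \<open>The geometric expansion of \<open>1 / (exp t - 1)\<close> produces terms whose integrals
  are those of the digamma series. For \<open>x \<ge> 0\<close> they are non-negative and serve as
  their own majorants.\<close>

lemma Digamma_integral: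
  fixes x :: real
  assumes x: "x \<ge> 0"
  shows "((\<lambda>t. (1 - exp (- (x * t))) / (exp t - 1)) has_integral (Digamma (x + 1) + euler_mascheroni)) {0<..}"
proof -
  define f where "f k t = exp (- (real (Suc k) * t)) - exp (- ((x + 1 + real k) * t))" for k t
  have f: "(f k has_integral (1 / real (Suc k) - 1 / (x + 1 + real k))) {0<..}" for k
    unfolding f_def using x by (intro has_integral_diff has_integral_exp_neg_Ioi) auto
  have "summable (\<lambda>k. inverse (of_nat (Suc k)) - inverse (x + 1 + of_nat k))"
    using x by (intro summable_Digamma) auto
  then have J: "summable (\<lambda>k. 1 / real (Suc k) - 1 / (x + 1 + real k))"
    by (simp add: inverse_eq_divide)
  have le: "norm (f k t) \<le> f k t" if "t \<in> {0<..}" for k t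
    using that x by (simp add: f_def mult_right_mono)
  have sums: "(\<lambda>k. f k t) sums ((1 - exp (- (x * t))) / (exp t - 1))" if t: "t \<in> {0<..}" for t
  proof -
    have "(\<lambda>k. exp (- (real (Suc k) * t)) * (1 - exp (- (x * t)))) sums (1 / (exp t - 1) * (1 - exp (- (x * t))))"
      using t by (intro sums_mult2 exp_geometric_sums) auto
    moreover have "exp (- (real (Suc k) * t)) * (1 - exp (- (x * t))) = f k t" for k
      by (simp add: f_def right_diff_distrib exp_add[symmetric] algebra_simps)
    ultimately show ?thesis
      by simp
  qed
  have hsum: "summable (\<lambda>k. f k t)" if "t \<in> {0<..}" for t
    using sums[OF that] by (rule sums_summable)
  have "((\<lambda>t. (1 - exp (- (x * t))) / (exp t - 1)) has_integral (\<Sum>k. 1 / real (Suc k) - 1 / (x + 1 + real k))) {0<..}"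
    by (rule has_integral_sums(2)[OF f f J le hsum sums])
  then show ?thesis
    by (simp add: Digamma_def inverse_eq_divide)
qed

text \<open>\<open>ln (1 - exp (- t))\<close> is a primitive of \<open>1 / (exp t - 1)\<close>;
  subtracting \<open>ln t\<close> removes its singularity, with limit 0 at 0. The value at
  \<open>pi\<close> of the first logarithm cancels against the tail integral.\<close>

lemma ln_one_minus_exp_neg_integral_near:
  "((\<lambda>t. 1 / (exp t - 1) - 1 / t) has_integral (ln (1 - exp (- pi)) - ln pi)) {0<..pi}"
proof -
  define F where "F t = (if t = 0 then 0 else ln ((1 - exp (- t)) / t))" for t :: real
  have "((\<lambda>t. 1 / (exp t - 1) - 1 / t) has_integral (F pi - F 0)) {0..pi}"
  proof (rule fundamental_theorem_of_calculus_interior)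
    show "continuous_on {0..pi} F"
    proof -
      have "continuous (at t within {0..pi}) F" if t: "t \<in> {0..pi}" for t
      proof (cases "t = 0")
        case True
        have "((\<lambda>t::real. ln ((1 - exp (- t)) / t)) \<longlongrightarrow> 0) (at_right 0)"
          by real_asymp
        then have "(F \<longlongrightarrow> 0) (at_right 0)"
          by (rule tendsto_cong[THEN iffD1, rotated])
             (auto simp: F_def eventually_at_filter)
        then have "(F \<longlongrightarrow> F 0) (at 0 within {0..pi})"
          by (simp add: at_within_Icc_at_right F_def)
        with True show ?thesis
          by (simp add: continuous_within)
      next
        case False
        with t have "t > 0"
          by simp
        then have "isCont (\<lambda>t. ln ((1 - exp (- t)) / t)) t"
          by (intro continuous_intros) auto
        moreover have "\<forall>\<^sub>F s in nhds t. s \<in> {0<..}"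
          using \<open>t > 0\<close> by (intro eventually_nhds_in_open) auto
        then have "\<forall>\<^sub>F s in nhds t. F s = ln ((1 - exp (- s)) / s)"
          by eventually_elim (simp add: F_def)
        ultimately have "isCont F t"
          by (subst isCont_cong)
        then show ?thesis
          by (rule continuous_at_imp_continuous_at_within)
      qed
      then show ?thesis
        by (simp add: continuous_on_eq_continuous_within)
    qed
    show "(F has_vector_derivative (1 / (exp t - 1) - 1 / t)) (at t)" if t: "t \<in> {0<..<pi}" for t
    proof -
      have "((\<lambda>t. ln (1 - exp (- t)) - ln t) has_real_derivative (1 / (exp t - 1) - 1 / t)) (at t)"
        using t by (auto intro!: derivative_eq_intros simp: exp_minus field_simps)
      moreover have "\<forall>\<^sub>F s in nhds t. ln (1 - exp (- s)) - ln s = F s"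
      proof -
        have "\<forall>\<^sub>F s in nhds t. s \<in> {0<..}"
          using t by (intro eventually_nhds_in_open) auto
        then show ?thesis
          by eventually_elim (simp add: F_def ln_div)
      qed
      ultimately have "(F has_real_derivative (1 / (exp t - 1) - 1 / t)) (at t)"
        by (simp add: DERIV_cong_ev)
      then show ?thesis
        by (simp add: has_real_derivative_iff_has_vector_derivative)
    qed
  qed simp
  moreover have "F pi - F 0 = ln (1 - exp (- pi)) - ln pi"
    by (simp add: F_def ln_div)
  ultimately show ?thesis
    by (subst has_integral_spike_set_eq[of "{0<..pi}" "{0..pi}"]) (auto intro: negligible_subset[of "{0}"])
qed

lemma ln_one_minus_exp_neg_integral_tail:
  "((\<lambda>t. 1 / (exp t - 1)) has_integral (- ln (1 - exp (- pi)))) {pi..}"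
proof (rule has_integral_to_inf)
  have *: "((\<lambda>t. 1 / (exp t - 1)) has_integral (ln (1 - exp (- y)) - ln (1 - exp (- pi)))) {pi..y}" if y: "y \<ge> pi" for y
  proof (rule fundamental_theorem_of_calculus[OF y])
    fix t assume t: "t \<in> {pi..y}"
    then have "t > 0"
      using pi_gt_zero by (simp del: pi_gt_zero)
    then have "((\<lambda>t. ln (1 - exp (- t))) has_real_derivative (1 / (exp t - 1))) (at t within {pi..y})"
      by (auto intro!: derivative_eq_intros simp: exp_minus field_simps)
    then show "((\<lambda>t. ln (1 - exp (- t))) has_vector_derivative (1 / (exp t - 1))) (at t within {pi..y})"
      by (simp add: has_real_derivative_iff_has_vector_derivative)
  qed
  show "(\<lambda>t. 1 / (exp t - 1)) integrable_on {pi..y}" for y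
    using * by (cases "y \<ge> pi") auto
  have "((\<lambda>y::real. ln (1 - exp (- y)) - ln (1 - exp (- pi))) \<longlongrightarrow> 0 - ln (1 - exp (- pi))) at_top"
  proof (intro tendsto_diff tendsto_const)
    show "((\<lambda>y::real. ln (1 - exp (- y))) \<longlongrightarrow> 0) at_top"
      by real_asymp
  qed
  moreover have "\<forall>\<^sub>F y in at_top. ln (1 - exp (- y)) - ln (1 - exp (- pi)) = integral {pi..y} (\<lambda>t. 1 / (exp t - 1))"
    using eventually_ge_at_top[of pi] by eventually_elim (rule integral_unique[OF *, symmetric])
  ultimately show "((\<lambda>y. integral {pi..y} (\<lambda>t. 1 / (exp t - 1))) \<longlongrightarrow> - ln (1 - exp (- pi))) at_top"
    by (simp add: tendsto_cong)
  show "1 / (exp y - 1) \<ge> 0" if "y \<ge> pi" for y :: real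
    using order_trans[OF pi_ge_zero that] by simp
qed

text \<open>After \<open>Digamma_integral\<close> is inserted, integration over \<open>x\<close>
  comes first and gives \<open>1 / z - 1 / (t + z)\<close>. This vanishes at \<open>t = 0\<close>
  and so compensates the pole of \<open>1 / (exp t - 1)\<close>.\<close>

lemma Digamma_laplace:
  fixes z :: real
  assumes z: "0 < z" "z < pi"
  shows "((\<lambda>x. exp (- (x * z)) * (Digamma (x + 1) + euler_mascheroni)) has_integral
     ((ln (1 + z / pi) - ln z) / z
       - integral {0<..pi} (\<lambda>t. (1 / (exp t - 1) - 1 / t) / (t + z))
       - integral {pi..} (\<lambda>t. 1 / ((exp t - 1) * (t + z))))) {0<..}"
proof (rule has_integral_Tonelli[where T = "{0<..}" and f = "\<lambda>x t. exp (- (x * z)) * ((1 - exp (- (x * t))) / (exp t - 1))"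
      and h = "\<lambda>t. (1 / z - 1 / (t + z)) / (exp t - 1)"])
  show "(\<lambda>(x, t). exp (- (x * z)) * ((1 - exp (- (x * t))) / (exp t - 1))) \<in> borel_measurable (borel \<Otimes>\<^sub>M borel)"
    by measurable
  show "exp (- (x * z)) * ((1 - exp (- (x * t))) / (exp t - 1)) \<ge> 0" if "x \<in> {0<..}" "t \<in> {0<..}" for x t :: real
    using that by simp
  show "((\<lambda>t. exp (- (x * z)) * ((1 - exp (- (x * t))) / (exp t - 1))) has_integral
      exp (- (x * z)) * (Digamma (x + 1) + euler_mascheroni)) {0<..}" if "x \<in> {0<..}" for x
    using that by (intro has_integral_mult_right Digamma_integral) auto
  show "((\<lambda>x. exp (- (x * z)) * ((1 - exp (- (x * t))) / (exp t - 1))) has_integral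
      (1 / z - 1 / (t + z)) / (exp t - 1)) {0<..}" if t: "t \<in> {0<..}" for t
  proof -
    have "((\<lambda>x. (exp (- (z * x)) - exp (- ((t + z) * x))) / (exp t - 1)) has_integral
      (1 / z - 1 / (t + z)) / (exp t - 1)) {0<..}"
      using t z by (intro has_integral_divide has_integral_diff has_integral_exp_neg_Ioi) auto
    moreover have "(exp (- (z * x)) - exp (- ((t + z) * x))) / (exp t - 1) =
        exp (- (x * z)) * ((1 - exp (- (x * t))) / (exp t - 1))" for x
      by (simp add: algebra_simps exp_add[symmetric] diff_divide_distrib)
    ultimately show ?thesis
      by simp
  qed
  let ?near = "integral {0<..pi} (\<lambda>t. (1 / (exp t - 1) - 1 / t) / (t + z))"
  let ?far = "integral {pi..} (\<lambda>t. 1 / ((exp t - 1) * (t + z)))"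
  have "((\<lambda>t. t ^ 0 / (t + z)) has_integral (ln (1 + z / pi) + (ln pi - ln z))) {0<..pi}"
    using has_integral_inverse_linear[OF z(1)]
    by (subst has_integral_spike_set_eq[of "{0<..pi}" "{0..pi}"]) (auto intro: negligible_subset[of "{0}"])
  \<comment> \<open>With the pole \<open>1 / t\<close> split off, the pieces are integrable
    separately; \<open>(1 / t) * (1 / z - 1 / (t + z))\<close> equals
    \<open>1 / (z * (t + z))\<close>, which accounts for the middle summand.\<close>
  then have "((\<lambda>t. ((1 / (exp t - 1) - 1 / t) + t ^ 0 / (t + z)) / z - (1 / (exp t - 1) - 1 / t) / (t + z)) has_integral
      (((ln (1 - exp (- pi)) - ln pi) + (ln (1 + z / pi) + (ln pi - ln z))) / z - ?near)) {0<..pi}"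
    by (intro has_integral_diff has_integral_divide has_integral_add ln_one_minus_exp_neg_integral_near
        integrable_integral has_integral_integrable[OF bernoulli_coeff_integral[OF z]])
  then have near: "((\<lambda>t. (1 / z - 1 / (t + z)) / (exp t - 1)) has_integral
      (((ln (1 - exp (- pi)) - ln pi) + (ln (1 + z / pi) + (ln pi - ln z))) / z - ?near)) {0<..pi}"
  proof (rule has_integral_eq[rotated])
    fix t assume "t \<in> {0<..pi}"
    then have t: "t > 0"
      by simp
    define p where "p = 1 / (exp t - 1)"
    have "(p - 1 / t + t ^ 0 / (t + z)) / z - (p - 1 / t) / (t + z) = (1 / z - 1 / (t + z)) * p"
      using t z by (simp add: divide_simps) (simp add: algebra_simps)
    then show "((1 / (exp t - 1) - 1 / t) + t ^ 0 / (t + z)) / z - (1 / (exp t - 1) - 1 / t) / (t + z) =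
      (1 / z - 1 / (t + z)) / (exp t - 1)"
      by (simp add: p_def)
  qed
  have "((\<lambda>t. 1 / (exp t - 1) / z - 1 / ((exp t - 1) * (t + z))) has_integral (- ln (1 - exp (- pi)) / z - ?far)) {pi..}"
    by (intro has_integral_diff has_integral_divide ln_one_minus_exp_neg_integral_tail
        integrable_integral zeta_tail_series_integrable z)
  then have far: "((\<lambda>t. (1 / z - 1 / (t + z)) / (exp t - 1)) has_integral (- ln (1 - exp (- pi)) / z - ?far)) {pi..}"
    by (rule has_integral_eq[rotated]) (simp add: diff_divide_distrib mult.commute)
  have "((\<lambda>t. (1 / z - 1 / (t + z)) / (exp t - 1)) has_integral
      ((((ln (1 - exp (- pi)) - ln pi) + (ln (1 + z / pi) + (ln pi - ln z))) / z - ?near) +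
       (- ln (1 - exp (- pi)) / z - ?far))) ({0<..pi} \<union> {pi..})"
    by (intro has_integral_Un near far) (auto intro: negligible_subset[of "{pi}"])
  also have "{0<..pi} \<union> {pi..} = {0<..}"
    using pi_gt_zero by (auto simp del: pi_gt_zero)
  also have "(((ln (1 - exp (- pi)) - ln pi) + (ln (1 + z / pi) + (ln pi - ln z))) / z - ?near) +
       (- ln (1 - exp (- pi)) / z - ?far) = (ln (1 + z / pi) - ln z) / z - ?near - ?far"
    by (simp add: add_divide_distrib diff_divide_distrib)
  finally show "((\<lambda>t. (1 / z - 1 / (t + z)) / (exp t - 1)) has_integral
     ((ln (1 + z / pi) - ln z) / z - ?near - ?far)) {0<..}" .
qed simp_all

text \<open>For \<open>n \<ge> 1\<close>, \<open>zeta_coeff n\<close> is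
  \<open>Polygamma n 1\<close>, so the Borel transform is the Taylor series of
  \<open>Digamma (w + 1)\<close> without its constant term \<open>- euler_mascheroni\<close>. The
  poles are negative integers, off the half-line.\<close>

lemma borel_continuation_zeta_coeff:
  "borel_continuation zeta_coeff (\<lambda>w. Digamma (w + 1) + euler_mascheroni)"
proof -
  have coeff: "zeta_coeff n / fact n = (if n = 0 then 0 else Polygamma n 1 / fact n)" for n
  proof (cases "n = 0")
    case False
    have "(\<lambda>k. inverse ((1 + of_nat k) ^ Suc n)) sums ((-1) ^ Suc n * Polygamma n 1 / fact n :: complex)"
      using False by (intro Polygamma_LIMSEQ) auto
    moreover have "(\<lambda>k. 1 / of_nat (Suc k) powr of_nat (n + 1)) sums zeta (of_nat (n + 1))"
      using False by (intro zeta_sums) auto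
    moreover have "(\<lambda>k. 1 / complex_of_nat (Suc k) powr of_nat (n + 1)) = (\<lambda>k. inverse ((1 + of_nat k) ^ Suc n))"
    proof
      fix k
      have "complex_of_nat (Suc k) powr of_nat (n + 1) = of_nat (Suc k) ^ (n + 1)"
        by (intro powr_nat') simp
      then show "1 / complex_of_nat (Suc k) powr of_nat (n + 1) = inverse ((1 + of_nat k) ^ Suc n)"
        by (simp only: inverse_eq_divide) simp
    qed
    ultimately have "zeta (of_nat (n + 1)) = (-1) ^ Suc n * Polygamma n 1 / fact n"
      using sums_unique2 by metis
    then have "zeta_coeff n = ((-1) ^ (n + 1) * (-1) ^ Suc n) * Polygamma n 1"
      using False by (simp add: zeta_coeff_def)
    also have "(-1) ^ (n + 1) * (-1) ^ Suc n = (1 :: complex)"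
      by (simp flip: power_mult_distrib)
    finally show ?thesis
      using False by simp
  qed (simp add: zeta_coeff_def)
  have sums: "(\<lambda>n. zeta_coeff n / fact n * w ^ n) sums (Digamma (w + 1) + euler_mascheroni)" if w: "w \<in> ball 0 1" for w
  proof -
    have hol: "Digamma holomorphic_on ball (1 :: complex) 1"
    proof (intro holomorphic_on_Polygamma equals0I)
      fix x :: complex assume "x \<in> ball 1 1 \<inter> \<int>\<^sub>\<le>\<^sub>0"
      then obtain n where x: "x = - of_nat n" "norm (1 - x) < 1"
        by (auto simp: dist_norm elim: nonpos_Ints_cases')
      then have "norm (of_nat (Suc n) :: complex) < 1"
        by simp
      then show False
        unfolding norm_of_nat by simp
    qed
    have "(\<lambda>n. (deriv ^^ n) Digamma 1 / fact n * ((w + 1) - 1) ^ n) sums Digamma (w + 1)"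
      using w by (intro holomorphic_power_series[OF hol]) (simp add: dist_norm)
    moreover have "(deriv ^^ n) Digamma 1 = (Polygamma n 1 :: complex)" for n
      using higher_deriv_Polygamma[of "1 :: complex" n 0] by simp
    ultimately have "(\<lambda>n. Polygamma n 1 / fact n * w ^ n) sums Digamma (w + 1)"
      by simp
    moreover have "(\<lambda>n. if n = 0 then euler_mascheroni else 0) sums (euler_mascheroni :: complex)"
      using sums_single[of 0 "\<lambda>_. euler_mascheroni :: complex"] by simp
    ultimately have "(\<lambda>n. Polygamma n 1 / fact n * w ^ n + (if n = 0 then euler_mascheroni else 0)) sums (Digamma (w + 1) + euler_mascheroni)"
      by (rule sums_add)
    moreover have "Polygamma n 1 / fact n * w ^ n + (if n = 0 then euler_mascheroni else 0) = zeta_coeff n / fact n * w ^ n" for n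
      by (simp add: coeff)
    ultimately show ?thesis
      by simp
  qed
  show ?thesis
    unfolding borel_continuation_def
  proof (intro conjI)
    have "summable (\<lambda>n. zeta_coeff n / fact n * (1 / 2) ^ n)"
      using sums[of "1 / 2"] by (auto simp: sums_iff)
    then have "conv_radius (\<lambda>n. zeta_coeff n / fact n) \<ge> norm (1 / 2 :: complex)"
      by (rule conv_radius_geI)
    then show "conv_radius (\<lambda>n. zeta_coeff n / fact n) > 0"
      by (rule less_le_trans[rotated]) simp
    show "(\<lambda>w. Digamma (w + 1) + euler_mascheroni) analytic_on complex_of_real ` {0..}"
    proof (intro analytic_intros ballI)
      fix w assume "w \<in> complex_of_real ` {0..}"
      then show "w + 1 \<notin> \<int>\<^sub>\<le>\<^sub>0"
        by (auto elim!: nonpos_Ints_cases' simp: complex_eq_iff)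
    qed
    have "\<forall>\<^sub>F w in nhds 0. w \<in> ball (0 :: complex) 1"
      by (intro eventually_nhds_in_open) auto
    then show "\<forall>\<^sub>F w in nhds 0. (\<lambda>n. zeta_coeff n / fact n * w ^ n) sums (Digamma (w + 1) + euler_mascheroni)"
      by eventually_elim (rule sums)
  qed
qed

section \<open>Borel summability and the value of the Borel sum\<close>

lemma Digamma_nonneg: "x \<ge> 0 \<Longrightarrow> Digamma (x + 1) + euler_mascheroni \<ge> (0 :: real)"
  by (rule has_integral_nonneg[OF Digamma_integral]) auto

text \<open>\<open>borel_summable\<close> asks for all \<open>z > 0\<close>, while
  \<open>Digamma_laplace\<close> covers \<open>z < pi\<close>. The integrand is non-negative, so the
  one with exponent \<open>min z 1\<close> dominates.\<close>

lemma Digamma_laplace_integrable: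
  fixes z :: real
  assumes z: "0 < z"
  shows "(\<lambda>x. exp (- (x * z)) * (Digamma (x + 1) + euler_mascheroni)) integrable_on {0..}"
proof -
  define y where "y = min z 1"
  have y: "0 < y" "y < pi" "y \<le> z"
    using z pi_gt3 by (auto simp: y_def)
  have "(\<lambda>x. exp (- (x * y)) * (Digamma (x + 1) + euler_mascheroni)) integrable_on {0..}"
    using has_integral_integrable[OF Digamma_laplace[OF y(1,2)]]
    by (subst integrable_spike_set_eq[of "{0..}" "{0<..}"]) (auto intro: negligible_subset[of "{0}"])
  moreover have "continuous_on {0..} (\<lambda>x. exp (- (x * z)) * (Digamma (x + 1) + euler_mascheroni))"
    by (intro continuous_intros continuous_on_compose2[OF continuous_on_Polygamma[of "{0<..}"]])
       (auto elim!: nonpos_Ints_cases)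
  ultimately have "(\<lambda>x. exp (- (x * z)) * (Digamma (x + 1) + euler_mascheroni)) absolutely_integrable_on {0..}"
  proof (rule_tac measurable_bounded_by_integrable_imp_absolutely_integrable
      [OF continuous_imp_measurable_on_sets_lebesgue])
    fix x :: real assume x: "x \<in> {0..}"
    then have "exp (- (x * z)) * (Digamma (x + 1) + euler_mascheroni) \<le> exp (- (x * y)) * (Digamma (x + 1) + euler_mascheroni)"
      using y Digamma_nonneg[of x] by (intro mult_right_mono) (auto intro: mult_left_mono)
    then show "norm (exp (- (x * z)) * (Digamma (x + 1) + euler_mascheroni)) \<le> exp (- (x * y)) * (Digamma (x + 1) + euler_mascheroni)"
      using x Digamma_nonneg[of x] by (simp add: abs_mult)
  qed auto
  then show ?thesis
    by (rule set_lebesgue_integral_eq_integral)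
qed

lemma Digamma_Borel_transform:
  assumes "x \<ge> 0"
  shows "exp (- (x * z)) *\<^sub>R (Digamma (complex_of_real x + 1) + euler_mascheroni) =
    of_real (exp (- (x * z)) * (Digamma (x + 1) + euler_mascheroni))"
proof -
  have "Digamma (complex_of_real (x + 1)) = of_real (Digamma (x + 1))"
    using assms by (intro Polygamma_of_real) auto
  then show ?thesis
    by (simp add: scaleR_conv_of_real)
qed

lemma borel_summable_zeta_coeff: "borel_summable zeta_coeff"
  unfolding borel_summable_def laplace_converges_def
proof (intro exI conjI allI impI)
  show "borel_continuation zeta_coeff (\<lambda>w. Digamma (w + 1) + euler_mascheroni)"
    by (rule borel_continuation_zeta_coeff)
  fix z :: real assume z: "z > 0"
  have "(\<lambda>x. complex_of_real (exp (- (x * z)) * (Digamma (x + 1) + euler_mascheroni))) integrable_on {0..}"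
    using Digamma_laplace_integrable[OF z] has_integral_of_real by (blast intro: integrable_integral has_integral_integrable)
  then show "(\<lambda>x. exp (- (x * z)) *\<^sub>R (Digamma (complex_of_real x + 1) + euler_mascheroni)) integrable_on {0..}"
    by (rule integrable_eq) (rule Digamma_Borel_transform[symmetric], simp)
qed

lemma borel_sum_zeta_coeff:
  fixes z :: real
  assumes z: "0 < z" "z < pi"
  shows "borel_sum zeta_coeff z = of_real ((ln (1 + z / pi) - ln z) / z
       - integral {0<..pi} (\<lambda>t. (1 / (exp t - 1) - 1 / t) / (t + z))
       - integral {pi..} (\<lambda>t. 1 / ((exp t - 1) * (t + z))))" (is "_ = of_real ?I")
proof -
  \<comment> \<open>\<open>borel_sum\<close> uses a Hilbert choice of continuation; on the half-line
    it must agree with the digamma expression.\<close>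
  define g where "g = (SOME g. borel_continuation zeta_coeff g)"
  have g: "borel_continuation zeta_coeff g"
    unfolding g_def by (rule someI[where P = "borel_continuation zeta_coeff", OF borel_continuation_zeta_coeff])
  have "((\<lambda>x. complex_of_real (exp (- (x * z)) * (Digamma (x + 1) + euler_mascheroni))) has_integral of_real ?I) {0<..}"
    by (rule has_integral_of_real[OF Digamma_laplace[OF z]])
  then have "((\<lambda>x. complex_of_real (exp (- (x * z)) * (Digamma (x + 1) + euler_mascheroni))) has_integral of_real ?I) {0..}"
    by (subst has_integral_spike_set_eq[of "{0..}" "{0<..}"]) (auto intro: negligible_subset[of "{0}"])
  then have "((\<lambda>x. exp (- (x * z)) *\<^sub>R g (of_real x)) has_integral of_real ?I) {0..}"
  proof (rule has_integral_eq[rotated])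
    fix x :: real assume "x \<in> {0..}"
    then have x: "x \<ge> 0"
      by simp
    show "of_real (exp (- (x * z)) * (Digamma (x + 1) + euler_mascheroni)) = exp (- (x * z)) *\<^sub>R g (of_real x)"
      unfolding Digamma_Borel_transform[OF x, symmetric]
        borel_continuation_unique[OF g borel_continuation_zeta_coeff x] ..
  qed
  then show ?thesis
    unfolding borel_sum_def laplace_def g_def[symmetric] by (rule integral_unique)
qed

section \<open>The exponential integral\<close>

lemma harm_exp_summable: "summable (\<lambda>j. z ^ j / fact j * harm j :: real)"
proof -
  have "summable (\<lambda>j. \<bar>z\<bar> * (inverse (fact j) * \<bar>z\<bar> ^ j))"
    by (intro summable_mult summable_exp)
  moreover have "\<bar>z\<bar> * (inverse (fact j) * \<bar>z\<bar> ^ j) = real (Suc j) * \<bar>z\<bar> ^ Suc j / fact (Suc j)" for j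
    by (simp add: inverse_eq_divide del: of_nat_Suc)
  ultimately have "summable (\<lambda>j. real (Suc j) * \<bar>z\<bar> ^ Suc j / fact (Suc j))"
    by simp
  then have "summable (\<lambda>j. real j * \<bar>z\<bar> ^ j / fact j)"
    by (subst (asm) summable_Suc_iff)
  then show ?thesis
  proof (rule summable_comparison_test')
    fix j :: nat
    have "\<bar>z\<bar> ^ j / fact j * harm j \<le> \<bar>z\<bar> ^ j / fact j * real j"
      by (intro mult_left_mono harm_le) auto
    then show "norm (z ^ j / fact j * harm j) \<le> real j * \<bar>z\<bar> ^ j / fact j"
      using harm_nonneg[of j, where ?'a = real] by (simp add: abs_mult power_abs mult.commute)
  qed
qed

text \<open>Without \<open>exp z\<close> this is the entire exponential integral Ein. Multiplication
  by \<open>exp z\<close> makes the expansion non-negative: the coefficient of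
  \<open>z ^ j / fact j\<close> becomes \<open>(1 - (1 - u) ^ j) / u\<close>, a sum of powers of
  \<open>1 - u\<close> with integral \<open>harm j\<close>.\<close>

lemma harm_exp_integral:
  fixes z :: real
  assumes z: "z > 0"
  shows "((\<lambda>u. exp z * ((1 - exp (- (z * u))) / u)) has_integral (\<Sum>j. z ^ j / fact j * harm j)) {0<..1}"
proof -
  define f where "f j u = z ^ j / fact j * (\<Sum>i<j. (1 - u) ^ i)" for j and u :: real
  have pow: "((\<lambda>u. (1 - u) ^ i) has_integral (1 / real (Suc i))) {0<..1}" for i
  proof -
    have "((\<lambda>u. (1 - u) ^ i) has_integral (- ((1 - 1) ^ Suc i / real (Suc i)) - - ((1 - 0) ^ Suc i / real (Suc i)))) {0..1}"
      by (intro fundamental_theorem_of_calculus)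
        (auto intro!: derivative_eq_intros simp del: power_Suc of_nat_Suc
        simp flip: has_real_derivative_iff_has_vector_derivative)
    then show ?thesis
      by (subst has_integral_spike_set_eq[of "{0<..1}" "{0..1}"]) (auto intro: negligible_subset[of "{0}"])
  qed
  have "harm j = (\<Sum>i<j. 1 / real (Suc i))" for j
    by (induction j) (auto simp: harm_Suc inverse_eq_divide harm_def)
  then have f: "(f j has_integral z ^ j / fact j * harm j) {0<..1}" for j
    unfolding f_def by (simp only:) (intro has_integral_mult_right has_integral_sum pow finite_lessThan)
  have le: "norm (f j u) \<le> f j u" if "u \<in> {0<..1}" for j u
    using that z unfolding f_def by (simp add: sum_nonneg)
  have sums: "(\<lambda>j. f j u) sums (exp z * ((1 - exp (- (z * u))) / u))" if u: "u \<in> {0<..1}" for u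
  proof -
    have "(\<lambda>j. (z ^ j /\<^sub>R fact j - (z * (1 - u)) ^ j /\<^sub>R fact j) / u) sums ((exp z - exp (z * (1 - u))) / u)"
      by (intro sums_divide sums_diff exp_converges)
    moreover have "(z ^ j /\<^sub>R fact j - (z * (1 - u)) ^ j /\<^sub>R fact j) / u = f j u" for j
    proof -
      have "u * (\<Sum>i<j. (1 - u) ^ i) = 1 - (1 - u) ^ j"
        using one_diff_power_eq[of "1 - u" j] by simp
      then have eq: "(\<Sum>i<j. (1 - u) ^ i) = (1 - (1 - u) ^ j) / u"
        using u by (simp add: field_simps)
      define q where "q = (1 - u) ^ j"
      have "(z * (1 - u)) ^ j = z ^ j * q"
        by (simp only: power_mult_distrib q_def)
      then show ?thesis
        unfolding f_def eq q_def[symmetric] by (simp add: divide_inverse algebra_simps)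
    qed
    moreover have "(exp z - exp (z * (1 - u))) / u = exp z * ((1 - exp (- (z * u))) / u)"
      by (simp add: right_diff_distrib exp_diff exp_minus divide_inverse)
    ultimately show ?thesis
      by simp
  qed
  have hsum: "summable (\<lambda>j. f j u)" if "u \<in> {0<..1}" for u
    using sums[OF that] by (rule sums_summable)
  show ?thesis
    by (rule has_integral_sums(2)[OF f f harm_exp_summable le hsum sums])
qed

text \<open>With \<open>s = 1 / (n + 1)\<close> this is the difference quotient at 0 of
  \<open>Gamma (1 + s) * z powr (- s)\<close>, because
  \<open>Gamma (1 + s) = s * Gamma s\<close>.\<close>

lemma Gamma_scaled_limit:
  fixes z :: real
  assumes z: "z > 0"
  shows "(\<lambda>n. Gamma (1 / real (Suc n)) / z powr (1 / real (Suc n)) - real (Suc n)) \<longlonglongrightarrow> - euler_mascheroni - ln z"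
proof -
  define F where "F s = Gamma (1 + s) * z powr (- s)" for s :: real
  have "(F has_real_derivative (Gamma (1 + 0) * Digamma (1 + 0) * (0 + 1) * z powr (- 0) +
      z powr (- 0) * ln z * (- 1) * Gamma (1 + 0))) (at 0)"
    unfolding F_def using z by (auto intro!: derivative_eq_intros)
  then have "((\<lambda>h. (F (0 + h) - F 0) / h) \<longlongrightarrow> - euler_mascheroni - ln z) (at 0)"
    using z by (simp add: DERIV_def)
  moreover have "filterlim (\<lambda>n. 1 / real (Suc n)) (at 0) sequentially"
    by real_asymp
  ultimately have "(\<lambda>n. (F (0 + 1 / real (Suc n)) - F 0) / (1 / real (Suc n))) \<longlonglongrightarrow> - euler_mascheroni - ln z"
    by (rule filterlim_compose)
  moreover have "(F (0 + 1 / real (Suc n)) - F 0) / (1 / real (Suc n)) =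
      Gamma (1 / real (Suc n)) / z powr (1 / real (Suc n)) - real (Suc n)" for n
  proof -
    have "Gamma (1 / real (Suc n) + 1) = 1 / real (Suc n) * Gamma (1 / real (Suc n))"
    proof (rule Gamma_plus1)
      show "1 / real (Suc n) \<notin> \<int>\<^sub>\<le>\<^sub>0"
      proof
        assume "1 / real (Suc n) \<in> \<int>\<^sub>\<le>\<^sub>0"
        then have "1 / real (Suc n) \<le> 0"
          by (rule nonpos_Ints_nonpos)
        then show False
          by simp
      qed
    qed
    then have F1: "F (1 / real (Suc n)) = 1 / real (Suc n) * (Gamma (1 / real (Suc n)) / z powr (1 / real (Suc n)))"
      by (simp add: F_def add.commute[of 1] powr_minus divide_inverse del: of_nat_Suc)
    have F0: "F 0 = 1"
      using z by (simp add: F_def)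
    have eq: "(1 / a * b - 1) / (1 / a) = b - a" if "a \<noteq> 0" for a b :: real
      using that by (simp add: field_simps)
    show ?thesis
      unfolding add_0_left F1 F0 by (rule eq) simp
  qed
  ultimately show ?thesis
    by simp
qed

text \<open>The limit \<open>s \<longrightarrow> 0\<close> of the Gamma integral, from which the divergent part
  \<open>1 / s\<close>, the integral of \<open>u powr (s - 1)\<close> over \<open>{0<..1}\<close>, has been removed.\<close>

lemma exp_integral_regularised:
  fixes z :: real
  assumes z: "z > 0"
  shows "((\<lambda>u. (exp (- (z * u)) - (if u \<le> 1 then 1 else 0)) / u) has_integral (- euler_mascheroni - ln z)) {0<..}"
proof -
  define s where "s n = 1 / real (Suc n)" for n
  have s: "0 < s n" "s n \<le> 1" for n
    by (auto simp: s_def)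
  \<comment> \<open>A majorant independent of \<open>n\<close>: up to 1,
    \<open>1 - exp (- (z * u)) \<le> z * u\<close> cancels the singular power; beyond 1,
    \<open>s n \<le> 1\<close> makes the power at most 1.\<close>
  define h where "h u = (if u \<le> 1 then z else exp (- (z * u)))" for u
  have pow: "((\<lambda>u. if u \<in> {0<..1} then u powr (s n - 1) else 0) has_integral real (Suc n)) {0<..}" for n
  proof -
    have "((\<lambda>u. u powr (s n - 1)) has_integral (1 powr (s n - 1 + 1) / (s n - 1 + 1))) {0..1}"
      using s[of n] by (intro has_integral_powr_from_0) auto
    then have "((\<lambda>u. u powr (s n - 1)) has_integral real (Suc n)) {0<..1}"
      by (subst has_integral_spike_set_eq[of "{0<..1}" "{0..1}"]) (auto simp: s_def intro: negligible_subset[of "{0}"])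
    then show ?thesis
      by (subst has_integral_restrict) auto
  qed
  have 1: "((\<lambda>u. u powr (s n - 1) * exp (- (z * u)) - (if u \<in> {0<..1} then u powr (s n - 1) else 0)) has_integral
      (Gamma (1 / real (Suc n)) / z powr (1 / real (Suc n)) - real (Suc n))) {0<..}" for n
    using has_integral_Gamma_scaled_real[of "s n" z] s[of n] z unfolding s_def
    by (intro has_integral_diff pow[unfolded s_def]) auto
  have "h integrable_on {0<..1} \<union> {1..}"
  proof (rule integrable_Un)
    have "(\<lambda>u. z) integrable_on {0..1::real}"
      by (rule integrable_const_ivl)
    then have "(\<lambda>u. z) integrable_on {0<..1::real}"
      by (subst integrable_spike_set_eq[of "{0<..1}" "{0..1}"]) (auto intro: negligible_subset[of "{0}"])
    then show "h integrable_on {0<..1}"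
      by (rule integrable_eq) (auto simp: h_def)
    have "(\<lambda>u. exp (- z * u)) integrable_on {1..}"
      using z by (rule integrable_on_exp_minus_to_infinity)
    then show "h integrable_on {1..}"
      by (rule integrable_spike[of _ _ "{1}"]) (auto simp: h_def)
  qed (auto intro: negligible_subset[of "{1}"])
  also have "{0<..1} \<union> {1..} = {0::real<..}"
    by auto
  finally have 2: "h integrable_on {0<..}" .
  show ?thesis
  proof (rule has_integral_dominated_convergence[OF 1 2 _ _ Gamma_scaled_limit[OF z]])
    show "\<forall>u\<in>{0<..}. norm (u powr (s n - 1) * exp (- (z * u)) - (if u \<in> {0<..1} then u powr (s n - 1) else 0)) \<le> h u" for n
    proof
      fix u :: real assume "u \<in> {0<..}"
      then have u: "u > 0"
        by simp
      show "norm (u powr (s n - 1) * exp (- (z * u)) - (if u \<in> {0<..1} then u powr (s n - 1) else 0)) \<le> h u"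
      proof (cases "u \<le> 1")
        case True
        have "1 - exp (- (z * u)) \<le> z * u"
          using exp_ge_add_one_self[of "- (z * u)"] by simp
        then have "u powr (s n - 1) * (1 - exp (- (z * u))) \<le> u powr (s n - 1) * (z * u)"
          by (intro mult_left_mono) auto
        also have "\<dots> = z * u powr (s n)"
          using u by (simp add: powr_diff)
        also have "\<dots> \<le> z * 1"
          using z u True s[of n] by (intro mult_left_mono powr_le1) auto
        finally have "u powr (s n - 1) * (1 - exp (- (z * u))) \<le> z"
          by simp
        moreover have "u powr (s n - 1) * (1 - exp (- (z * u))) \<ge> 0"
          using u z by simp
        ultimately show ?thesis
          using True u by (simp add: h_def right_diff_distrib abs_if)
      next
        case False
        then have "u powr (s n - 1) \<le> u powr 0"
          using s[of n] by (intro powr_mono) auto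
        then have "u powr (s n - 1) * exp (- (z * u)) \<le> 1 * exp (- (z * u))"
          using False by (intro mult_right_mono) auto
        with False show ?thesis
          by (simp add: h_def abs_mult)
      qed
    qed
    show "\<forall>u\<in>{0<..}. (\<lambda>n. u powr (s n - 1) * exp (- (z * u)) - (if u \<in> {0<..1} then u powr (s n - 1) else 0))
      \<longlonglongrightarrow> (exp (- (z * u)) - (if u \<le> 1 then 1 else 0)) / u"
    proof
      fix u :: real assume "u \<in> {0<..}"
      then have u: "u > 0"
        by simp
      have "s \<longlonglongrightarrow> 0"
        unfolding s_def by real_asymp
      then have "(\<lambda>n. u powr (s n - 1) * (exp (- (z * u)) - (if u \<le> 1 then 1 else 0))) \<longlonglongrightarrow>
          u powr (0 - 1) * (exp (- (z * u)) - (if u \<le> 1 then 1 else 0))"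
        using u by (intro tendsto_intros) auto
      moreover have "u powr (0 - 1) = 1 / u"
        using u by (simp add: powr_minus_divide)
      moreover have "u powr (s n - 1) * (exp (- (z * u)) - (if u \<le> 1 then 1 else 0)) =
          u powr (s n - 1) * exp (- (z * u)) - (if u \<in> {0<..1} then u powr (s n - 1) else 0)" for n
        using u by (simp add: right_diff_distrib)
      ultimately show "(\<lambda>n. u powr (s n - 1) * exp (- (z * u)) - (if u \<in> {0<..1} then u powr (s n - 1) else 0))
          \<longlonglongrightarrow> (exp (- (z * u)) - (if u \<le> 1 then 1 else 0)) / u"
        by simp
    qed
  qed
qed

text \<open>The substitution \<open>u = x + 1\<close> turns the transform into \<open>exp z\<close>
  times the integral of \<open>exp (- (z * u)) / u\<close> over \<open>{1<..}\<close>. That integral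
  is the regularised one plus the Ein integral over \<open>{0<..1}\<close>, whose integrands cancel
  below 1.\<close>

lemma laplace_inverse_linear:
  fixes z :: real
  assumes z: "z > 0"
  shows "((\<lambda>x. exp (- (x * z)) * (1 / (x + 1))) has_integral
     (\<Sum>j. z ^ j / fact j * harm j) - exp z * (euler_mascheroni + ln z)) {0..}"
proof -
  let ?h = "\<Sum>j. z ^ j / fact j * harm j"
  let ?G = "\<lambda>u. (exp (- (z * u)) - (if u \<le> 1 then 1 else 0)) / u"
  have "((\<lambda>u. exp (- z) * (exp z * ((1 - exp (- (z * u))) / u))) has_integral exp (- z) * ?h) {0<..1}"
    by (intro has_integral_mult_right harm_exp_integral z)
  then have "((\<lambda>u. (1 - exp (- (z * u))) / u) has_integral exp (- z) * ?h) {0<..1}"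
    by (simp only: mult.assoc[symmetric] exp_add[symmetric]) simp
  then have "((\<lambda>u. if u \<in> {0<..1} then (1 - exp (- (z * u))) / u else 0) has_integral exp (- z) * ?h) {0<..}"
    by (subst has_integral_restrict) auto
  with exp_integral_regularised[OF z] have "((\<lambda>u. ?G u + (if u \<in> {0<..1} then (1 - exp (- (z * u))) / u else 0)) has_integral
      (- euler_mascheroni - ln z + exp (- z) * ?h)) {0<..}"
    by (rule has_integral_add)
  then have "((\<lambda>u. if u \<in> {1<..} then exp (- (z * u)) / u else 0) has_integral
      (- euler_mascheroni - ln z + exp (- z) * ?h)) {0<..}"
    by (rule has_integral_eq[rotated]) (auto simp: diff_divide_distrib)
  then have *: "((\<lambda>u. exp (- (z * u)) / u) has_integral (- euler_mascheroni - ln z + exp (- z) * ?h)) {1<..}"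
    by (subst (asm) has_integral_restrict) auto
  have "(\<lambda>u. exp (- (z * u)) / u) absolutely_integrable_on {1<..} \<and>
      integral {1<..} (\<lambda>u. exp (- (z * u)) / u) = - euler_mascheroni - ln z + exp (- z) * ?h"
    using * by (subst absolutely_integrable_on_iff_nonneg) (auto simp: integral_unique)
  moreover have "(\<lambda>x. x + 1) ` {0<..} = {1::real<..}"
    by (auto simp: image_iff intro!: bexI[of _ "_ - 1"])
  ultimately have "(\<lambda>x. \<bar>1\<bar> *\<^sub>R (exp (- (z * (x + 1))) / (x + 1))) absolutely_integrable_on {0<..} \<and>
      integral {0<..} (\<lambda>x. \<bar>1\<bar> *\<^sub>R (exp (- (z * (x + 1))) / (x + 1))) = - euler_mascheroni - ln z + exp (- z) * ?h"
    by (subst has_absolute_integral_change_of_variables_real[where g = "\<lambda>x. x + 1"])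
       (auto intro!: derivative_eq_intros inj_onI)
  then have "((\<lambda>x. \<bar>1\<bar> *\<^sub>R (exp (- (z * (x + 1))) / (x + 1))) has_integral (- euler_mascheroni - ln z + exp (- z) * ?h)) {0<..}"
    using set_lebesgue_integral_eq_integral(1) has_integral_integrable_integral by blast
  then have "((\<lambda>x. exp z * (\<bar>1\<bar> *\<^sub>R (exp (- (z * (x + 1))) / (x + 1)))) has_integral exp z * (- euler_mascheroni - ln z + exp (- z) * ?h)) {0<..}"
    by (rule has_integral_mult_right)
  then have "((\<lambda>x. exp (- (x * z)) * (1 / (x + 1))) has_integral exp z * (- euler_mascheroni - ln z + exp (- z) * ?h)) {0<..}"
  proof (rule has_integral_eq[rotated])
    fix x :: real
    have "exp z * exp (- (z * (x + 1))) = exp (- (x * z))"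
      by (simp add: exp_add[symmetric] algebra_simps)
    then show "exp z * (\<bar>1\<bar> *\<^sub>R (exp (- (z * (x + 1))) / (x + 1))) = exp (- (x * z)) * (1 / (x + 1))"
      by simp
  qed
  moreover have "exp z * (- euler_mascheroni - ln z + exp (- z) * ?h) = ?h - exp z * (euler_mascheroni + ln z)"
    by (simp add: exp_minus algebra_simps)
  ultimately have "((\<lambda>x. exp (- (x * z)) * (1 / (x + 1))) has_integral (?h - exp z * (euler_mascheroni + ln z))) {0<..}"
    by (simp only:)
  then show ?thesis
    by (subst has_integral_spike_set_eq[of "{0..}" "{0<..}"]) (auto intro: negligible_subset[of "{0}"])
qed

section \<open>The identity\<close>

context
  fixes z :: real
  assumes z: "0 < z" "z < pi"
begin

section \<open>Closed forms of the series on the right-hand side\<close>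

lemma harm_exp_series_shift:
  "(\<lambda>k. z ^ k / fact (Suc k) * harm (Suc k)) sums ((\<Sum>j. z ^ j / fact j * harm j) / z)"
proof -
  have "(\<lambda>j. z ^ j / fact j * harm j) sums (\<Sum>j. z ^ j / fact j * harm j)"
    by (rule summable_sums[OF harm_exp_summable])
  then have "(\<lambda>k. z ^ Suc k / fact (Suc k) * harm (Suc k)) sums (\<Sum>j. z ^ j / fact j * harm j)"
    by (subst sums_Suc_iff) (simp add: harm_def)
  then have "(\<lambda>k. z ^ Suc k / fact (Suc k) * harm (Suc k) / z) sums ((\<Sum>j. z ^ j / fact j * harm j) / z)"
    by (rule sums_divide)
  moreover have "z ^ Suc k / fact (Suc k) * harm (Suc k) / z = z ^ k / fact (Suc k) * harm (Suc k)" for k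
    using z by simp
  ultimately show ?thesis
    by simp
qed

lemma summable_exp_integral_series: "summable (\<lambda>k. z ^ k / fact (k + 1) * (1 / real (k + 1)))"
proof (rule summable_comparison_test')
  show "summable (\<lambda>k. inverse (fact k) * z ^ k)"
    by (rule summable_exp)
  fix k :: nat
  have "real (k + 1) * fact k * real (k + 1) \<ge> 1 * fact k * 1"
    by (intro mult_mono) auto
  then have "z ^ k / (real (k + 1) * fact k * real (k + 1)) \<le> z ^ k / (1 * fact k * 1)"
    using z by (intro divide_left_mono mult_pos_pos) auto
  then show "norm (z ^ k / fact (k + 1) * (1 / real (k + 1))) \<le> inverse (fact k) * z ^ k"
    using z by (simp add: divide_inverse mult_ac)
qed

text \<open>With \<open>m = i + 1\<close> the inner sum is a Cauchy product: the Taylor series of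
  \<open>1 / (exp z - 1) - 1 / z\<close> times the series of
  \<open>harm j * z ^ j / fact j\<close>.\<close>

lemma bernoulli_harm_Cauchy_sums:
  "(\<lambda>k. z ^ k * (\<Sum>m=1..k. bernoulli m / fact m * (harm (k - m + 1) / fact (k - m + 1)))) sums
     ((1 / (exp z - 1) - 1 / z) * (\<Sum>j. z ^ j / fact j * harm j))"
proof -
  let ?a = "\<lambda>m. bernoulli_coeff m * z ^ m" and ?h = "\<lambda>j. z ^ j / fact j * harm j"
  have "(\<lambda>k. \<Sum>i\<le>k. ?a i * ?h (k - i)) sums (suminf ?a * suminf ?h)"
  proof (rule Cauchy_product_sums)
    show "summable (\<lambda>m. norm (?a m))"
    proof (rule summable_comparison_test'[OF summable_bernoulli_coeff])
      fix m :: nat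
      have "\<bar>bernoulli_coeff m\<bar> * z ^ m \<le> \<bar>bernoulli_coeff m\<bar> * pi ^ m"
        using z by (intro mult_left_mono power_mono) auto
      then show "norm (norm (?a m)) \<le> \<bar>bernoulli_coeff m\<bar> * pi ^ m"
        using z by (simp add: abs_mult)
    qed
    have "norm (?h j) = ?h j" for j
      using z by (simp add: abs_mult harm_nonneg)
    then show "summable (\<lambda>j. norm (?h j))"
      using harm_exp_summable[of z] by simp
  qed
  moreover have "suminf ?a = 1 / (exp z - 1) - 1 / z"
    using z by (intro sums_unique[symmetric] bernoulli_coeff_sums) auto
  moreover have "(\<Sum>i\<le>k. ?a i * ?h (k - i)) =
     z ^ k * (\<Sum>m=1..k. bernoulli m / fact m * (harm (k - m + 1) / fact (k - m + 1)))" for k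
  proof -
    \<comment> \<open>The top index drops out because \<open>harm 0 = 0\<close>, so the shifted sum
      ends at \<open>m = k\<close>.\<close>
    have "(\<Sum>i\<le>k. ?a i * ?h (k - i)) = (\<Sum>i<k. ?a i * ?h (k - i))"
      by (simp add: lessThan_Suc_atMost[symmetric] harm_def)
    also have "\<dots> = (\<Sum>i<k. z ^ k * (bernoulli (Suc i) / fact (Suc i) * (harm (k - i) / fact (k - i))))"
    proof (rule sum.cong)
      fix i assume "i \<in> {..<k}"
      then have "z ^ k = z ^ i * z ^ (k - i)"
        by (simp flip: power_add)
      then show "?a i * ?h (k - i) = z ^ k * (bernoulli (Suc i) / fact (Suc i) * (harm (k - i) / fact (k - i)))"
        by (simp only: bernoulli_coeff_def) simp
    qed simp
    also have "\<dots> = (\<Sum>m=1..k. z ^ k * (bernoulli m / fact m * (harm (k - m + 1) / fact (k - m + 1))))"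
      by (rule sum.reindex_bij_witness[of _ "\<lambda>m. m - 1" Suc]) (auto simp: Suc_diff_Suc simp del: fact_Suc)
    finally show ?thesis
      by (simp only: sum_distrib_left)
  qed
  ultimately show ?thesis
    by simp
qed

text \<open>Writing \<open>harm k\<close> as \<open>harm (Suc k) - 1 / (k + 1)\<close> splits off
  the other series of the right-hand side, which is why that one cancels in the end. The term with
  index 0 is zero, so starting at 1 changes nothing.\<close>

lemma zeta_values_harm_sums:
  "(\<lambda>k. z ^ Suc k / fact (Suc k) * harm (Suc k) * ((1 - bernoulli (Suc k + 1)) / real (Suc k + 1))) sums
     ((\<Sum>j. z ^ j / fact j * harm j) / z - (\<Sum>k. z ^ k / fact (k + 1) * (1 / real (k + 1)))
       - (\<Sum>k. bernoulli_coeff k * (harm k * z ^ k)))"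
proof -
  have "(\<lambda>k. z ^ k / fact (Suc k) * harm (Suc k) - z ^ k / fact (k + 1) * (1 / real (k + 1))
      - bernoulli_coeff k * (harm k * z ^ k)) sums
     ((\<Sum>j. z ^ j / fact j * harm j) / z - (\<Sum>k. z ^ k / fact (k + 1) * (1 / real (k + 1)))
       - (\<Sum>k. bernoulli_coeff k * (harm k * z ^ k)))"
    by (intro sums_diff harm_exp_series_shift summable_sums summable_exp_integral_series
        summable_bernoulli_coeff_harm z)
  moreover have "z ^ k / fact (Suc k) * harm (Suc k) - z ^ k / fact (k + 1) * (1 / real (k + 1))
      - bernoulli_coeff k * (harm k * z ^ k) =
     z ^ k / fact k * harm k * ((1 - bernoulli (k + 1)) / real (k + 1))" for k
  proof -
    have "fact (Suc k) = real (Suc k) * fact k"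
      by simp
    then show ?thesis
      by (simp only: bernoulli_coeff_def harm_Suc Suc_eq_plus1[symmetric])
         (simp add: field_simps del: of_nat_Suc fact_Suc)
  qed
  ultimately have "(\<lambda>k. z ^ k / fact k * harm k * ((1 - bernoulli (k + 1)) / real (k + 1))) sums
     ((\<Sum>j. z ^ j / fact j * harm j) / z - (\<Sum>k. z ^ k / fact (k + 1) * (1 / real (k + 1)))
       - (\<Sum>k. bernoulli_coeff k * (harm k * z ^ k)))"
    by simp
  then show ?thesis
    by (subst sums_Suc_iff) (simp add: harm_def)
qed

lemma zeta_deriv_sums:
  "(\<lambda>k. complex_of_real z ^ k / fact k * deriv zeta (- of_nat k)) sums
     of_real ((1 / (exp (- z) - 1) - 1 / (- z)) * (euler_mascheroni + ln z)
       + (\<Sum>k. bernoulli_coeff k * (harm k * z ^ k))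
       - ln (1 + z / pi) / z
       + integral {0<..pi} (\<lambda>t. (1 / (exp t - 1) - 1 / t) / (t + z))
       + integral {pi..} (\<lambda>t. 1 / ((exp t - 1) * (t + z))))" (is "_ sums of_real ?I")
proof -
  have "(\<lambda>k. complex_of_real ((- z) ^ k * zeta_deriv_coeff k)) sums of_real ?I"
    by (intro sums_of_real zeta_deriv_coeff_sums z)
  moreover have "complex_of_real z ^ k / fact k * deriv zeta (- of_nat k) = of_real ((- z) ^ k * zeta_deriv_coeff k)" for k
    unfolding deriv_zeta_neg_nat by (simp add: power_minus[of z] power_minus[of "complex_of_real z"])
  ultimately show ?thesis
    by (simp only:)
qed

end

theorem theorem2:
  fixes z :: real
  assumes "0 < z" and "z < pi"
  shows
    "summable (\<lambda>k. complex_of_real z ^ k / fact k * deriv zeta (- of_nat k)) \<and>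
     borel_summable zeta_coeff \<and>
     laplace_converges (\<lambda>x::real. 1 / (x + 1)) z \<and>
     summable (\<lambda>k. z ^ k / fact (k + 1) * (1 / real (k + 1))) \<and>
     summable (\<lambda>k. z ^ k *
        (\<Sum>m=1..k. bernoulli m / fact m * (harm (k - m + 1) / fact (k - m + 1)))) \<and>
     summable (\<lambda>k. z ^ Suc k / fact (Suc k) *
        harm (Suc k) * ((1 - bernoulli (Suc k + 1)) / real (Suc k + 1))) \<and>
     (\<Sum>k. complex_of_real z ^ k / fact k * deriv zeta (- of_nat k))
        - complex_of_real (euler_mascheroni / z) + borel_sum zeta_coeff z
     = complex_of_real
        (1 / (exp z - 1) * laplace (\<lambda>x. 1 / (x + 1)) z
         - (\<Sum>k. z ^ k / fact (k + 1) * (1 / real (k + 1)))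
         - (\<Sum>k. z ^ k *
              (\<Sum>m=1..k. bernoulli m / fact m * (harm (k - m + 1) / fact (k - m + 1))))
         - (\<Sum>k. z ^ Suc k / fact (Suc k) *
              harm (Suc k) * ((1 - bernoulli (Suc k + 1)) / real (Suc k + 1))))"
proof (intro conjI)
  note z = assms
  let ?h = "\<Sum>j. z ^ j / fact j * harm j" and ?A = "\<Sum>k. z ^ k / fact (k + 1) * (1 / real (k + 1))"
  let ?U = "\<Sum>k. bernoulli_coeff k * (harm k * z ^ k)"
  let ?near = "integral {0<..pi} (\<lambda>t. (1 / (exp t - 1) - 1 / t) / (t + z))"
  let ?far = "integral {pi..} (\<lambda>t. 1 / ((exp t - 1) * (t + z)))"
  note zeta_deriv = zeta_deriv_sums[OF z] and cauchy = bernoulli_harm_Cauchy_sums[OF z]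
    and harm = zeta_values_harm_sums[OF z]
  have lap: "((\<lambda>x. exp (- (x * z)) *\<^sub>R (1 / (x + 1))) has_integral ?h - exp z * (euler_mascheroni + ln z)) {0..}"
    using laplace_inverse_linear[OF z(1)] by simp
  show "summable (\<lambda>k. complex_of_real z ^ k / fact k * deriv zeta (- of_nat k))"
    by (rule sums_summable[OF zeta_deriv])
  show "borel_summable zeta_coeff"
    by (rule borel_summable_zeta_coeff)
  show "laplace_converges (\<lambda>x::real. 1 / (x + 1)) z"
    unfolding laplace_converges_def by (rule has_integral_integrable[OF lap])
  show "summable (\<lambda>k. z ^ k / fact (k + 1) * (1 / real (k + 1)))"
    by (rule summable_exp_integral_series[OF z])
  show "summable (\<lambda>k. z ^ k * (\<Sum>m=1..k. bernoulli m / fact m * (harm (k - m + 1) / fact (k - m + 1))))"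
    by (rule sums_summable[OF cauchy])
  show "summable (\<lambda>k. z ^ Suc k / fact (Suc k) * harm (Suc k) * ((1 - bernoulli (Suc k + 1)) / real (Suc k + 1)))"
    by (rule sums_summable[OF harm])
  have L: "laplace (\<lambda>x. 1 / (x + 1)) z = ?h - exp z * (euler_mascheroni + ln z)"
    unfolding laplace_def by (rule integral_unique[OF lap])
  have "exp z \<noteq> 1"
    using z by simp
  then have neg: "1 / (exp (- z) - 1) = - (exp z / (exp z - 1))"
    by (simp add: exp_minus divide_simps) (simp add: algebra_simps)
  \<comment> \<open>Both sides equal \<open>u - e / (e - 1) * (g + l)\<close>, with
    \<open>e\<close>, \<open>g\<close>, \<open>l\<close>, \<open>u\<close> for \<open>exp z\<close>,
    Euler's constant, \<open>ln z\<close> and \<open>?U\<close>. On the left the integrals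
    \<open>n\<close>, \<open>f\<close> and \<open>w = ln (1 + z / pi)\<close> cancel, on the right
    the series \<open>h\<close> and \<open>a\<close>.\<close>
  have alg: "(- (e / (e - 1)) - 1 / (- z)) * (g + l) + u - w / z + n + f - g / z + ((w - l) / z - n - f) =
      1 / (e - 1) * (h - e * (g + l)) - a - (1 / (e - 1) - 1 / z) * h - (h / z - a - u)"
    for e g l u w n f h a :: real
    by (simp add: algebra_simps add_divide_distrib diff_divide_distrib)
  show "(\<Sum>k. complex_of_real z ^ k / fact k * deriv zeta (- of_nat k))
        - complex_of_real (euler_mascheroni / z) + borel_sum zeta_coeff z
     = complex_of_real
        (1 / (exp z - 1) * laplace (\<lambda>x. 1 / (x + 1)) z - ?A
         - (\<Sum>k. z ^ k *
              (\<Sum>m=1..k. bernoulli m / fact m * (harm (k - m + 1) / fact (k - m + 1))))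
         - (\<Sum>k. z ^ Suc k / fact (Suc k) *
              harm (Suc k) * ((1 - bernoulli (Suc k + 1)) / real (Suc k + 1))))"
    unfolding sums_unique[OF zeta_deriv, symmetric] sums_unique[OF cauchy, symmetric]
      sums_unique[OF harm, symmetric] L borel_sum_zeta_coeff[OF z] neg
      of_real_diff[symmetric] of_real_add[symmetric]
    by (rule arg_cong[OF alg])
qed

end
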